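(* Let $(M,\omega)$ be an $n$-plectic manifold and let $\mathfrak g$ be a finite-dimensional real Lie algebra acting on $M$ and preserving $\omega$. The action admits (1) a $\mathfrak g$-equivariant weak moment map if and only if $[\widehat\omega]=0$ in $H^{n+1}(\widehat C^{\mathfrak g})$; (2) a $\mathfrak g$-equivariant homotopy moment map if and only if $[\widetilde\omega]=0$ in $H^{n+1}(\widetilde C^{\mathfrak g})$. Moreover, the respective equivariant moment maps are in one-to-one correspondence with the potentials of the respective classes, i.e. with the elements $\widehat\alpha=\sum_{k=1}^n\widehat\alpha_k\in\widehat C^{\mathfrak g}$ of total degree $n$ with $\widehat d_{tot}\widehat\alpha=\widehat\omega$ (respectively $\widetilde\alpha=\sum_{k=1}^n\widetilde\alpha_k\in\widetilde C^{\mathfrak g}$ of total degree $n$ with $\widetilde d_{tot}\widetilde\alpha=\widetilde\omega$), via $\widehat f_k=\zeta(k)\widehat\alpha_k$ (respectively $\widetilde f_k=\zeta(k)\widetilde\alpha_k$).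
   Context: $(M,\omega)$ is $n$-plectic ($n\ge 1$) if $\omega\in\Omega^{n+1}(M)$ is closed and $v\mapsto\iota_v\omega$ is injective as a map $TM\to\Lambda^nT^*M$. An action of $\mathfrak g$ is a Lie algebra homomorphism $\mathfrak g\to\mathfrak X(M)$, $x\mapsto v_x$; it preserves $\omega$ if $\mathcal L_{v_x}\omega=0$ for all $x\in\mathfrak g$. For $p=x_1\wedge\dots\wedge x_k\in\Lambda^k\mathfrak g$ put $v_p=v_{x_1}\wedge\dots\wedge v_{x_k}$ (extended linearly) and $\iota_{v_p}\omega=\iota_{v_{x_k}}\cdots\iota_{v_{x_1}}\omega$. The Lie algebra homology differential $\delta_k:\Lambda^k\mathfrak g\to\Lambda^{k-1}\mathfrak g$ ($k\ge1$) is $$\delta_k(x_1\wedge\dots\wedge x_k)=\sum_{1\le i<j\le k}(-1)^{i+j}[x_i,x_j]\wedge x_1\wedge\dots\widehat{x_i}\dots\widehat{x_j}\dots\wedge x_k,$$ $P_{k,\mathfrak g}=\ker\delta_k$, and $P_{\ge1,\mathfrak g}=\bigoplus_{k\ge1}P_{k,\mathfrak g}$. Put $\zeta(k)=-(-1)^{k(k+1)/2}$. A homotopy moment map is a collection of linear maps $\widetilde f_k:\Lambda^k\mathfrak g\to\Omega^{n-k}(M)$, $1\le k\le n$, such that $-\widetilde f_{k-1}(\delta_k p)=d\widetilde f_k(p)+\zeta(k)\iota_{v_p}\omega$ for all $p\in\Lambda^k\mathfrak g$, $1\le k\le n+1$, where $\widetilde f_0=\widetilde f_{n+1}=0$. A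 weak moment map is a collection of linear maps $\widehat f_k:P_{k,\mathfrak g}\to\Omega^{n-k}(M)$, $1\le k\le n$, such that $d\widehat f_k(p)=-\zeta(k)\iota_{v_p}\omega$ for all $p\in P_{k,\mathfrak g}$, $1\le k\le n$. Either is $\mathfrak g$-equivariant if $f_k(ad_xp)=\mathcal L_{v_x}f_k(p)$ for all $x\in\mathfrak g$, $1\le k\le n$, and all $p$ in the domain of $f_k$ (where $ad$ is the adjoint action of $\mathfrak g$ on $\Lambda^k\mathfrak g$, which preserves $P_{k,\mathfrak g}$). $\widetilde C=\Lambda^{\ge1}\mathfrak g^*\otimes\Omega(M)$ is the total complex graded by total degree, with differential $\widetilde d_{tot}=d_{\mathfrak g}\otimes1+1\otimes d$, where $(d_{\mathfrak g}\xi)(p)=\xi(\delta p)$, $d$ is the de Rham differential, and the Koszul sign convention is used ($1\otimes d$ acts on $\Lambda^k\mathfrak g^*\otimes\Omega(M)$ as $(-1)^kd$). $\widehat C=P_{\ge1,\mathfrak g}^*\otimes\Omega(M)$ is the total complex with $\widehat d_{tot}=1\otimes d$ (same sign convention). Elements of $\Lambda^k\mathfrak g^*\otimes\Omega(M)$ and $P_{k,\mathfrak g}^*\otimes\Omega(M)$ are viewed as linear maps $\Lambda^k\mathfrak g\to\Omega(M)$, $P_{k,\mathfrak g}\to\Omega(M)$. Let $\omega_k:\Lambda^k\mathfrak g\to\Omega^{n+1-k}(M)$, $p\mapsto\iota_{v_p}\omega$, $\widetilde\omega=\sum_{k=1}^{n+1}(-1)^{k-1}\omega_k\in\widetilde C$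 and $\widehat\omega=\sum_{k=1}^{n}(-1)^{k-1}\omega_k|_{P_{k,\mathfrak g}}\in\widehat C$. $\mathfrak g$ acts on $\widetilde C$ and $\widehat C$ by $(x\cdot\eta)(p)=\mathcal L_{v_x}(\eta(p))-\eta(ad_xp)$. $\widetilde C^{\mathfrak g}$ and $\widehat C^{\mathfrak g}$ are the subcomplexes of $\mathfrak g$-invariant elements; $\widetilde\omega$ and $\widehat\omega$ are closed and lie in them. *)

theory Defs
  imports
    "HOL-Analysis.Analysis"
    "HOL-Library.Function_Algebras"
    "HOL-Algebra.Coset"
begin

section \<open>Linear algebra\<close>

text \<open>
  Spaces of maps carry the pointwise vector space structure. A linear map whose domain is a
  subset of a type is totalised by the value 0, so that equality of such maps is equality
  on the domain.
\<close>

instantiation "fun" :: (type, real_vector) real_vector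
begin

definition scaleR_fun_def: "r *\<^sub>R f = (\<lambda>x. r *\<^sub>R f x)"

instance
  by standard (simp_all add: scaleR_fun_def fun_eq_iff algebra_simps)

end

lemma scaleR_fun_apply [simp]: "(r *\<^sub>R f) x = r *\<^sub>R f x"
  by (simp add: scaleR_fun_def)

definition finite_dim :: "'a::real_vector itself \<Rightarrow> bool" where
  "finite_dim _ \<longleftrightarrow> (\<exists>B :: 'a set. finite B \<and> span B = UNIV)"

definition linear_maps :: "'a::real_vector set \<Rightarrow> 'b::real_vector set \<Rightarrow> ('a \<Rightarrow> 'b) set" where
  "linear_maps V W = {f. (\<forall>p. p \<notin> V \<longrightarrow> f p = 0) \<and> f ` V \<subseteq> W \<and>
     (\<forall>p\<in>V. \<forall>q\<in>V. \<forall>a b. f (a *\<^sub>R p + b *\<^sub>R q) = a *\<^sub>R f p + b *\<^sub>R f q)}"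

text \<open>Alternating \<open>k\<close>-linear forms on a subspace \<open>V\<close>, with the arguments collected in a list.\<close>

definition alt_forms :: "nat \<Rightarrow> 'a::real_vector set \<Rightarrow> ('a list \<Rightarrow> real) set" where
  "alt_forms k V = {\<xi>.
     (\<forall>xs. \<not> (length xs = k \<and> set xs \<subseteq> V) \<longrightarrow> \<xi> xs = 0) \<and>
     (\<forall>xs i a b u w. length xs = k \<and> set xs \<subseteq> V \<and> i < k \<and> u \<in> V \<and> w \<in> V \<longrightarrow>
        \<xi> (xs[i := a *\<^sub>R u + b *\<^sub>R w]) = a * \<xi> (xs[i := u]) + b * \<xi> (xs[i := w])) \<and>
     (\<forall>xs. \<not> distinct xs \<longrightarrow> \<xi> xs = 0)}"

definition remove_nth :: "nat \<Rightarrow> 'a list \<Rightarrow> 'a list" where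
  "remove_nth i xs = take i xs @ drop (Suc i) xs"


section \<open>Exterior powers of a Lie algebra\<close>

definition lie_algebra :: "('g::real_vector \<Rightarrow> 'g \<Rightarrow> 'g) \<Rightarrow> bool" where
  "lie_algebra br \<longleftrightarrow> bilinear br \<and> (\<forall>x. br x x = 0) \<and>
     (\<forall>x y z. br x (br y z) + br y (br z x) + br z (br x y) = 0)"

text \<open>
  The exterior power \<open>\<Lambda>\<^sup>k \<gg>\<close> is realised inside the dual of the space of alternating
  \<open>k\<close>-linear forms: \<open>x\<^sub>1 \<and> \<dots> \<and> x\<^sub>k\<close> is the evaluation at \<open>(x\<^sub>1, \<dots>, x\<^sub>k)\<close>. A linear map on
  \<open>\<Lambda>\<^sup>k \<gg>\<close> that is prescribed on decomposable elements can then be defined by transposition;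
  the lemmas below recover the prescribed formulas.
\<close>

type_synonym 'g mvec = "('g list \<Rightarrow> real) \<Rightarrow> real"

definition wedge :: "'g::real_vector list \<Rightarrow> 'g mvec" where
  "wedge xs = (\<lambda>\<xi>. if \<xi> \<in> alt_forms (length xs) UNIV then \<xi> xs else 0)"

definition ext_power :: "nat \<Rightarrow> 'g::real_vector mvec set" where
  "ext_power k = span (wedge ` {xs. length xs = k})"

definition ce_differential :: "('g::real_vector \<Rightarrow> 'g \<Rightarrow> 'g) \<Rightarrow> ('g list \<Rightarrow> real) \<Rightarrow> 'g list \<Rightarrow> real" where
  "ce_differential br \<xi> xs = (\<Sum>j<length xs. \<Sum>i<j.
     (-1) ^ (i + j) * \<xi> (br (xs ! i) (xs ! j) # remove_nth i (remove_nth j xs)))"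

definition boundary :: "('g::real_vector \<Rightarrow> 'g \<Rightarrow> 'g) \<Rightarrow> nat \<Rightarrow> 'g mvec \<Rightarrow> 'g mvec" where
  "boundary br k p = (\<lambda>\<xi>. if \<xi> \<in> alt_forms (k - 1) UNIV then p (ce_differential br \<xi>) else 0)"

definition lie_kernel :: "('g::real_vector \<Rightarrow> 'g \<Rightarrow> 'g) \<Rightarrow> nat \<Rightarrow> 'g mvec set" where
  "lie_kernel br k = {p \<in> ext_power k. boundary br k p = 0}"

definition ad :: "('g::real_vector \<Rightarrow> 'g \<Rightarrow> 'g) \<Rightarrow> nat \<Rightarrow> 'g \<Rightarrow> 'g mvec \<Rightarrow> 'g mvec" where
  "ad br k x p = (\<lambda>\<xi>. if \<xi> \<in> alt_forms k UNIV
     then p (\<lambda>ys. \<Sum>i<length ys. \<xi> (ys[i := br x (ys ! i)])) else 0)"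

lemma alt_forms_not_distinct: "\<xi> \<in> alt_forms k V \<Longrightarrow> \<not> distinct xs \<Longrightarrow> \<xi> xs = 0"
  by (auto simp: alt_forms_def)

lemma alt_forms_outside: "\<xi> \<in> alt_forms k V \<Longrightarrow> length xs \<noteq> k \<Longrightarrow> \<xi> xs = 0"
  by (auto simp: alt_forms_def)

lemma alt_forms_linear:
  "\<xi> \<in> alt_forms k UNIV \<Longrightarrow> i < length xs \<Longrightarrow>
    \<xi> (xs[i := a *\<^sub>R u + b *\<^sub>R w]) = a * \<xi> (xs[i := u]) + b * \<xi> (xs[i := w])"
  by (cases "length xs = k") (auto simp: alt_forms_def)

lemma alt_forms_UNIV_iff:
  "\<xi> \<in> alt_forms k UNIV \<longleftrightarrow>
     (\<forall>xs. length xs \<noteq> k \<longrightarrow> \<xi> xs = 0) \<and>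
     (\<forall>xs i a b u w. i < length xs \<longrightarrow> length xs = k \<longrightarrow>
        \<xi> (xs[i := a *\<^sub>R u + b *\<^sub>R w]) = a * \<xi> (xs[i := u]) + b * \<xi> (xs[i := w])) \<and>
     (\<forall>xs. \<not> distinct xs \<longrightarrow> \<xi> xs = 0)"
  by (auto simp: alt_forms_def)

lemma wedge_linear:
  assumes "i < length xs"
  shows "wedge (xs[i := a *\<^sub>R u + b *\<^sub>R w]) = a *\<^sub>R wedge (xs[i := u]) + b *\<^sub>R wedge (xs[i := w])"
  using assms by (auto simp: wedge_def fun_eq_iff alt_forms_linear)

lemma wedge_not_distinct: "\<not> distinct xs \<Longrightarrow> wedge xs = 0"
  by (auto simp: wedge_def fun_eq_iff alt_forms_not_distinct)

lemma list_split2: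
  assumes "\<not> distinct xs"
  obtains as y bs cs where "xs = as @ y # bs @ y # cs"
  using not_distinct_decomp[OF assms] by auto

lemma adj_swap:
  fixes f :: "'a::real_vector list \<Rightarrow> real"
  assumes lin: "\<And>xs i a b u w. i < length xs \<Longrightarrow> length xs = k \<Longrightarrow>
     f (xs[i := a *\<^sub>R u + b *\<^sub>R w]) = a * f (xs[i := u]) + b * f (xs[i := w])"
    and adj: "\<And>as y cs. length (as @ y # y # cs) = k \<Longrightarrow> f (as @ y # y # cs) = 0"
    and len: "length as + length cs + 2 = k"
  shows "f (as @ y # z # cs) = - f (as @ z # y # cs)"
proof -
  have l1: "f (as @ (u + w) # t # cs) = f (as @ u # t # cs) + f (as @ w # t # cs)" for u w t
    using lin[of "length as" "as @ 0 # t # cs" 1 u 1 w] len by (simp add: list_update_append)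
  have l2: "f (as @ t # (u + w) # cs) = f (as @ t # u # cs) + f (as @ t # w # cs)" for u w t
    using lin[of "Suc (length as)" "as @ t # 0 # cs" 1 u 1 w] len by (simp add: list_update_append)
  have "f (as @ (y + z) # (y + z) # cs) = 0" "f (as @ y # y # cs) = 0" "f (as @ z # z # cs) = 0"
    using len by (auto intro!: adj)
  then show ?thesis by (simp add: l1 l2)
qed

lemma adj_alternating:
  fixes f :: "'a::real_vector list \<Rightarrow> real"
  assumes lin: "\<And>xs i a b u w. i < length xs \<Longrightarrow> length xs = k \<Longrightarrow>
     f (xs[i := a *\<^sub>R u + b *\<^sub>R w]) = a * f (xs[i := u]) + b * f (xs[i := w])"
    and adj: "\<And>as y cs. length (as @ y # y # cs) = k \<Longrightarrow> f (as @ y # y # cs) = 0"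
  shows "length (as @ y # bs @ y # cs) = k \<Longrightarrow> f (as @ y # bs @ y # cs) = 0"
proof (induction bs arbitrary: as)
  case Nil then show ?case using adj by simp
next
  case (Cons b bs)
  have "f (as @ y # b # (bs @ y # cs)) = - f (as @ b # y # (bs @ y # cs))"
    using lin adj Cons.prems by (intro adj_swap[of k f]) auto
  also have "f (as @ b # y # (bs @ y # cs)) = 0"
    using Cons.IH[of "as @ [b]"] Cons.prems by simp
  finally show ?case by simp
qed

lemma alt_forms_UNIV_I:
  assumes "\<And>xs. length xs \<noteq> k \<Longrightarrow> \<xi> xs = 0"
    and lin: "\<And>xs i a b u w. i < length xs \<Longrightarrow> length xs = k \<Longrightarrow>
     \<xi> (xs[i := a *\<^sub>R u + b *\<^sub>R w]) = a * \<xi> (xs[i := u]) + b * \<xi> (xs[i := w])"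
    and adj: "\<And>as y cs. length (as @ y # y # cs) = k \<Longrightarrow> \<xi> (as @ y # y # cs) = 0"
  shows "\<xi> \<in> alt_forms k UNIV"
proof -
  have "\<xi> xs = 0" if "\<not> distinct xs" for xs
  proof (cases "length xs = k")
    case True
    obtain as y bs cs where xs: "xs = as @ y # bs @ y # cs" using list_split2[OF \<open>\<not> distinct xs\<close>] .
    show ?thesis unfolding xs by (rule adj_alternating[of k \<xi>]) (use lin adj True xs in auto)
  qed (use assms in auto)
  then show ?thesis using assms by (auto simp: alt_forms_UNIV_iff)
qed

lemma length_remove_nth [simp]: "i < length xs \<Longrightarrow> length (remove_nth i xs) = length xs - 1"
  by (simp add: remove_nth_def)

lemma remove_nth_update:
  assumes "j < length xs" "i < length xs"
  shows "remove_nth j (xs[i := u]) = (if i = j then remove_nth j xs else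
      (remove_nth j xs)[(if i < j then i else i - 1) := u])"
  using assms by (auto simp: remove_nth_def list_eq_iff_nth_eq nth_append nth_list_update)


lemma remove_nth_adj:
  "Suc a < length xs \<Longrightarrow> xs ! a = xs ! Suc a \<Longrightarrow> remove_nth a xs = remove_nth (Suc a) xs"
  by (auto simp: remove_nth_def list_eq_iff_nth_eq nth_append min_def less_Suc_eq)

lemma remove_nth_adj_other:
  assumes "Suc a < length xs" "xs ! a = xs ! Suc a" "j < length xs" "j \<noteq> a" "j \<noteq> Suc a"
  defines "a' \<equiv> if a < j then a else a - 1"
  shows "Suc a' < length (remove_nth j xs) \<and> remove_nth j xs ! a' = remove_nth j xs ! Suc a'"
  using assms by (auto simp: remove_nth_def nth_append min_def)

lemma ce_differential_alt:
  assumes br: "lie_algebra br" and \<xi>: "\<xi> \<in> alt_forms k UNIV"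
  shows "ce_differential br \<xi> \<in> alt_forms (Suc k) UNIV"
proof (rule alt_forms_UNIV_I)
  have bl: "bilinear br" and b0: "\<And>x. br x x = 0" using br by (auto simp: lie_algebra_def)
  have br1: "br (a *\<^sub>R x + b *\<^sub>R y) z = a *\<^sub>R br x z + b *\<^sub>R br y z" for a b x y z
    using bl by (simp add: bilinear_ladd bilinear_lmul)
  have br2: "br z (a *\<^sub>R x + b *\<^sub>R y) = a *\<^sub>R br z x + b *\<^sub>R br z y" for a b x y z
    using bl by (simp add: bilinear_radd bilinear_rmul)
  have hd: "\<xi> ((a *\<^sub>R x + b *\<^sub>R y) # ys) = a * \<xi> (x # ys) + b * \<xi> (y # ys)" for a b x y ys
    using alt_forms_linear[OF \<xi>, of 0 "0 # ys" a x b y] by simp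
  have tl: "\<xi> (z # ys[i := a *\<^sub>R x + b *\<^sub>R y]) = a * \<xi> (z # ys[i := x]) + b * \<xi> (z # ys[i := y])"
    if "i < length ys" for a b x y z ys i
    using alt_forms_linear[OF \<xi>, of "Suc i" "z # ys" a x b y] that by simp
  fix xs
  show "ce_differential br \<xi> xs = 0" if "length xs \<noteq> Suc k"
    unfolding ce_differential_def
    using that by (intro sum.neutral ballI) (auto intro!: alt_forms_outside[OF \<xi>])
  fix m a b u w
  let ?T = "\<lambda>xs i j. \<xi> (br (xs ! i) (xs ! j) # remove_nth i (remove_nth j xs))"
  assume m: "m < length xs" 
  have "?T (xs[m := a *\<^sub>R u + b *\<^sub>R w]) i j = a * ?T (xs[m := u]) i j + b * ?T (xs[m := w]) i j"
    if "i < j" "j < length xs" for i j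
  proof -
    consider "m = i" | "m = j" | "m \<noteq> i" "m \<noteq> j" by blast
    then show ?thesis
    proof cases
      case 3
      define m1 where "m1 = (if m < j then m else m - 1)"
      define m2 where "m2 = (if m1 < i then m1 else m1 - 1)"
      have *: "remove_nth i (remove_nth j (xs[m := t])) = (remove_nth i (remove_nth j xs))[m2 := t]" for t
        using that 3 m by (auto simp: remove_nth_update m1_def m2_def)
      have "m2 < length (remove_nth i (remove_nth j xs))"
        using that 3 m by (auto simp: m1_def m2_def)
      then show ?thesis using 3 that by (simp add: * tl)
    qed (use m that in \<open>auto simp: remove_nth_update br1 br2 hd\<close>)
  qed
  then show "ce_differential br \<xi> (xs[m := a *\<^sub>R u + b *\<^sub>R w]) =
      a * ce_differential br \<xi> (xs[m := u]) + b * ce_differential br \<xi> (xs[m := w])"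
    unfolding ce_differential_def
    by (simp add: sum_distrib_left sum.distrib[symmetric] algebra_simps)
next
  have b0: "\<And>x. br x x = 0" using br by (auto simp: lie_algebra_def)
  have hd0: "\<xi> (0 # ys) = 0" for ys
    using alt_forms_linear[OF \<xi>, of 0 "0 # ys" 0 0 0 0] by simp
  fix as and y :: 'a and cs
  define xs where "xs = as @ y # y # cs"
  define a where "a = length as"
  define n where "n = length xs"
  have a: "Suc a < length xs" "xs ! a = xs ! Suc a" by (auto simp: xs_def a_def nth_append)
  define T where "T i j = (if i < j then
    (-1) ^ (i + j) * \<xi> (br (xs ! i) (xs ! j) # remove_nth i (remove_nth j xs)) else 0)" for i j
  define \<pi> where "\<pi> = Transposition.transpose a (Suc a)"
  have T: "T (\<pi> i) (\<pi> j) = - T i j" if "i < n" "j < n" for i j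
  proof -
    consider "i = a" "j = Suc a" | "j = a" "i = Suc a" | "i = j" | "i \<noteq> a" "i \<noteq> Suc a" "j \<noteq> a" "j \<noteq> Suc a"
      | "i \<in> {a, Suc a}" "j \<notin> {a, Suc a}" | "j \<in> {a, Suc a}" "i \<notin> {a, Suc a}" by blast
    then show ?thesis
    proof cases
      case 4
      have "T i j = 0"
      proof (cases "i < j")
        case True
        define a1 where "a1 = (if a < j then a else a - 1)"
        define a2 where "a2 = (if a1 < i then a1 else a1 - 1)"
        have 1: "Suc a1 < length (remove_nth j xs) \<and> remove_nth j xs ! a1 = remove_nth j xs ! Suc a1"
          unfolding a1_def using 4 a that by (intro remove_nth_adj_other) (auto simp: n_def)
        have "Suc a2 < length (remove_nth i (remove_nth j xs)) \<and>
           remove_nth i (remove_nth j xs) ! a2 = remove_nth i (remove_nth j xs) ! Suc a2"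
          unfolding a2_def using 1 4 that True by (intro remove_nth_adj_other) (auto simp: n_def a1_def)
        then have "\<not> distinct (remove_nth i (remove_nth j xs))"
          by (metis Suc_lessD distinct_conv_nth n_not_Suc_n)
        then show ?thesis by (simp add: T_def alt_forms_not_distinct[OF \<xi>])
      qed (simp add: T_def)
      then show ?thesis using 4 by (simp add: \<pi>_def Transposition.transpose_def)
    next
      case 5
      have "T a j = - T (Suc a) j"
      proof (cases "Suc a < j")
        case True
        have "Suc a < length (remove_nth j xs) \<and> remove_nth j xs ! a = remove_nth j xs ! Suc a"
          using remove_nth_adj_other[of a xs j] a True that by (auto simp: n_def)
        then have "remove_nth a (remove_nth j xs) = remove_nth (Suc a) (remove_nth j xs)"
          by (intro remove_nth_adj) auto
        then show ?thesis using True a by (simp add: T_def)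
      qed (use 5 in \<open>auto simp: T_def\<close>)
      then show ?thesis using 5 by (auto simp: \<pi>_def Transposition.transpose_def)
    next
      case 6
      have "T i a = - T i (Suc a)"
      proof (cases "i < a")
        case True
        then show ?thesis using a by (simp add: T_def remove_nth_adj[of a xs])
      qed (use 6 in \<open>auto simp: T_def\<close>)
      then show ?thesis using 6 by (auto simp: \<pi>_def Transposition.transpose_def)
    qed (use a in \<open>auto simp: T_def \<pi>_def Transposition.transpose_def b0 hd0\<close>)
  qed
  have bij: "bij_betw \<pi> {..<n} {..<n}"
    using a unfolding \<pi>_def n_def bij_betw_def
    by (auto simp: inj_on_def Transposition.transpose_def image_iff)
  have "ce_differential br \<xi> xs = (\<Sum>j<n. \<Sum>i<n. T i j)"
    unfolding ce_differential_def n_def T_def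
    by (intro sum.cong refl sum.mono_neutral_cong_left) auto
  moreover have "(\<Sum>j<n. \<Sum>i<n. T i j) = (\<Sum>j<n. \<Sum>i<n. T (\<pi> i) (\<pi> j))"
  proof -
    have "(\<Sum>i<n. T (\<pi> i) j) = (\<Sum>i<n. T i j)" for j
      by (rule sum.reindex_bij_betw[OF bij, of "\<lambda>i. T i j"])
    then have "(\<Sum>j<n. \<Sum>i<n. T i j) = (\<Sum>j<n. \<Sum>i<n. T (\<pi> i) j)" by simp
    also have "\<dots> = (\<Sum>j<n. \<Sum>i<n. T (\<pi> i) (\<pi> j))"
      by (rule sum.reindex_bij_betw[OF bij, of "\<lambda>j. \<Sum>i<n. T (\<pi> i) j", symmetric])
    finally show ?thesis .
  qed
  moreover have "\<dots> = - (\<Sum>j<n. \<Sum>i<n. T i j)"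
    by (simp add: T sum_negf)
  ultimately have "ce_differential br \<xi> xs = 0" by linarith
  then show "ce_differential br \<xi> (as @ y # y # cs) = 0" by (simp add: xs_def)
qed

lemma sum_fun_apply: "(\<Sum>i\<in>I. f i) x = (\<Sum>i\<in>I. f i x)" for f :: "_ \<Rightarrow> _ \<Rightarrow> _::comm_monoid_add"
  by (induction I rule: infinite_finite_induct) simp_all

lemma boundary_wedge:
  assumes "lie_algebra br"
  shows "boundary br (length xs) (wedge xs) = (\<Sum>j<length xs. \<Sum>i<j. (-1) ^ (i + j) *\<^sub>R
    wedge (br (xs ! i) (xs ! j) # remove_nth i (remove_nth j xs)))"
proof (cases xs)
  case Nil
  then show ?thesis by (simp add: boundary_def wedge_def ce_differential_def fun_eq_iff)
next
  case (Cons y ys)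
  then obtain n where n: "length xs = Suc n" by simp
  show ?thesis
  proof
    fix \<xi>
    show "boundary br (length xs) (wedge xs) \<xi> = (\<Sum>j<length xs. \<Sum>i<j. (-1) ^ (i + j) *\<^sub>R
        wedge (br (xs ! i) (xs ! j) # remove_nth i (remove_nth j xs))) \<xi>"
    proof (cases "\<xi> \<in> alt_forms n UNIV")
      case True
      show ?thesis 
        using True ce_differential_alt[OF assms True] n
        by (auto simp: boundary_def wedge_def sum_fun_apply ce_differential_def intro!: sum.cong)
    next
      case False
      then show ?thesis using n
        by (auto simp: boundary_def wedge_def sum_fun_apply intro!: sum.neutral)
    qed
  qed
qed

lemma ad_wedge:
  assumes br: "lie_algebra br"
  shows "ad br (length xs) x (wedge (xs :: 'a::real_vector list)) = (\<Sum>i<length xs. wedge (xs[i := br x (xs ! i)]))"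
proof
  fix \<xi> :: "'a list \<Rightarrow> real"
  define f where "f ys = (\<Sum>i<length ys. \<xi> (ys[i := br x (ys ! i)]))" for ys
  have bl: "bilinear br" using br by (auto simp: lie_algebra_def)
  have br2: "br z (a *\<^sub>R x + b *\<^sub>R y) = a *\<^sub>R br z x + b *\<^sub>R br z y" for a b x y z
    using bl by (simp add: bilinear_radd bilinear_rmul)
  have "f \<in> alt_forms (length xs) UNIV" if \<xi>: "\<xi> \<in> alt_forms (length xs) UNIV"
  proof (rule alt_forms_UNIV_I)
    fix ys :: "'a list" and m a b u w
    show "f ys = 0" if "length ys \<noteq> length xs"
      using that by (auto simp: f_def alt_forms_outside[OF \<xi>])
    assume m: "m < length ys"
    have "\<xi> (ys[m := a *\<^sub>R u + b *\<^sub>R w, i := br x (ys[m := a *\<^sub>R u + b *\<^sub>R w] ! i)]) =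
       a * \<xi> (ys[m := u, i := br x (ys[m := u] ! i)]) + b * \<xi> (ys[m := w, i := br x (ys[m := w] ! i)])"
      if "i < length ys" for i
    proof (cases "i = m")
      case True
      then show ?thesis using m by (simp add: br2 alt_forms_linear[OF \<xi>])
    next
      case False
      then show ?thesis using m 
        by (simp add: list_update_swap[of m i] alt_forms_linear[OF \<xi>])
    qed
    then show "f (ys[m := a *\<^sub>R u + b *\<^sub>R w]) = a * f (ys[m := u]) + b * f (ys[m := w])"
      by (simp add: f_def sum_distrib_left sum.distrib[symmetric])
  next
    fix as and y :: 'a and cs
    assume len: "length (as @ y # y # cs) = length xs"
    let ?ys = "as @ y # y # cs"
    have *: "\<xi> (as @ u # v # cs) = - \<xi> (as @ v # u # cs)" for u v
      using len by (intro adj_swap[of "length xs" \<xi>] alt_forms_linear[OF \<xi>])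
         (auto intro: alt_forms_not_distinct[OF \<xi>])
    have 0: "\<xi> (?ys[i := br x (?ys ! i)]) = 0" if "i < length ?ys" "i \<notin> {length as, Suc (length as)}" for i
    proof (rule alt_forms_not_distinct[OF \<xi>])
      have "?ys[i := br x (?ys ! i)] ! length as = ?ys[i := br x (?ys ! i)] ! Suc (length as)"
        using that by (auto simp: nth_list_update nth_append)
      then show "\<not> distinct (?ys[i := br x (?ys ! i)])"
        using len that by (metis add_Suc_right distinct_conv_nth length_Cons length_append length_list_update
            less_add_same_cancel1 n_not_Suc_n not_less_eq zero_less_Suc Suc_lessI)
    qed
    have "f ?ys = (\<Sum>i\<in>{length as, Suc (length as)}. \<xi> (?ys[i := br x (?ys ! i)]))"
      unfolding f_def using 0 by (intro sum.mono_neutral_right) auto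
    also have "\<dots> = 0" using *[of "br x y" y] by (simp add: list_update_append nth_append)
    finally show "f ?ys = 0" .
  qed
  moreover have "f = (\<lambda>ys. \<Sum>i<length ys. \<xi> (ys[i := br x (ys ! i)]))"
    by (simp add: f_def fun_eq_iff)
  ultimately show "ad br (length xs) x (wedge xs) \<xi> = (\<Sum>i<length xs. wedge (xs[i := br x (xs ! i)])) \<xi>"
    by (simp add: ad_def wedge_def sum_fun_apply)
qed



section \<open>Smooth manifolds\<close>

fun ck_on :: "nat \<Rightarrow> 'a::real_normed_vector set \<Rightarrow> ('a \<Rightarrow> 'b::real_normed_vector) \<Rightarrow> bool" where
  "ck_on 0 S f \<longleftrightarrow> continuous_on S f"
| "ck_on (Suc k) S f \<longleftrightarrow> (\<forall>x\<in>S. f differentiable (at x)) \<and>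
     (\<forall>w. ck_on k S (\<lambda>x. frechet_derivative f (at x) w))"

text \<open>Only used on open sets.\<close>

definition smooth_on :: "'a::real_normed_vector set \<Rightarrow> ('a \<Rightarrow> 'b::real_normed_vector) \<Rightarrow> bool" where
  "smooth_on S f \<longleftrightarrow> (\<forall>k. ck_on k S f)"

text \<open>
  A chart is a pair of its domain and its coordinate map. The model space is a
  finite-dimensional inner product space, not a \<open>euclidean_space\<close>, because the latter excludes
  dimension 0.
\<close>

type_synonym ('m, 'e) chart = "'m set \<times> ('m \<Rightarrow> 'e)"

definition coord_image :: "('m, 'e) chart \<Rightarrow> 'e set" where
  "coord_image c = snd c ` fst c"

definition coord_inv :: "('m, 'e) chart \<Rightarrow> 'e \<Rightarrow> 'm" where
  "coord_inv c = inv_into (fst c) (snd c)"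

definition smooth_manifold :: "'m topology \<Rightarrow> ('m, 'e::real_inner) chart set \<Rightarrow> bool" where
  "smooth_manifold M A \<longleftrightarrow>
     Hausdorff_space M \<and> second_countable M \<and> finite_dim TYPE('e) \<and>
     (\<forall>c\<in>A. openin M (fst c) \<and> open (coord_image c) \<and>
        homeomorphic_map (subtopology M (fst c)) (top_of_set (coord_image c)) (snd c)) \<and>
     (\<Union>c\<in>A. fst c) = topspace M \<and>
     (\<forall>c\<in>A. \<forall>c'\<in>A. smooth_on (snd c ` (fst c \<inter> fst c')) (snd c' \<circ> coord_inv c))"

text \<open>
  A tangent vector at \<open>m\<close> is the family of its coordinates in the charts around \<open>m\<close>, related by
  the differentials of the coordinate changes (and 0 at all other charts).
\<close>

type_synonym ('m, 'e) tvec = "('m, 'e) chart \<Rightarrow> 'e"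

definition coord_change :: "('m, 'e::real_inner) chart \<Rightarrow> ('m, 'e) chart \<Rightarrow> 'm \<Rightarrow> 'e \<Rightarrow> 'e" where
  "coord_change c c' m = frechet_derivative (snd c' \<circ> coord_inv c) (at (snd c m))"

definition tangent_space :: "('m, 'e::real_inner) chart set \<Rightarrow> 'm \<Rightarrow> ('m, 'e) tvec set" where
  "tangent_space A m = {u.
     (\<forall>c. \<not> (c \<in> A \<and> m \<in> fst c) \<longrightarrow> u c = 0) \<and>
     (\<forall>c\<in>A. \<forall>c'\<in>A. m \<in> fst c \<inter> fst c' \<longrightarrow> u c' = coord_change c c' m (u c))}"

text \<open>The tangent vector at \<open>m\<close> with coordinates \<open>w\<close> in the chart \<open>c\<close>.\<close>

definition tvec_of :: "('m, 'e::real_inner) chart set \<Rightarrow> ('m, 'e) chart \<Rightarrow> 'm \<Rightarrow> 'e \<Rightarrow> ('m, 'e) tvec" where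
  "tvec_of A c m w = (\<lambda>c'. if c' \<in> A \<and> m \<in> fst c' then coord_change c c' m w else 0)"

definition vector_fields :: "'m topology \<Rightarrow> ('m, 'e::real_inner) chart set \<Rightarrow> ('m \<Rightarrow> ('m, 'e) tvec) set" where
  "vector_fields M A = {X.
     (\<forall>m. m \<notin> topspace M \<longrightarrow> X m = 0) \<and> (\<forall>m\<in>topspace M. X m \<in> tangent_space A m) \<and>
     (\<forall>c\<in>A. smooth_on (coord_image c) (\<lambda>y. X (coord_inv c y) c))}"

definition vf_bracket :: "('m, 'e::real_inner) chart set \<Rightarrow> ('m \<Rightarrow> ('m, 'e) tvec) \<Rightarrow> ('m \<Rightarrow> ('m, 'e) tvec) \<Rightarrow>
    'm \<Rightarrow> ('m, 'e) tvec" where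
  "vf_bracket A X Y m c = (if c \<in> A \<and> m \<in> fst c then
       frechet_derivative (\<lambda>y. Y (coord_inv c y) c) (at (snd c m)) (X m c)
     - frechet_derivative (\<lambda>y. X (coord_inv c y) c) (at (snd c m)) (Y m c) else 0)"


section \<open>Differential forms\<close>

type_synonym ('m, 'e) dform = "'m \<Rightarrow> ('m, 'e) tvec list \<Rightarrow> real"

text \<open>Coordinate expression of a form in the chart \<open>c\<close>.\<close>

definition coord_form :: "('m, 'e::real_inner) chart set \<Rightarrow> ('m, 'e) chart \<Rightarrow> ('m, 'e) dform \<Rightarrow> 'e \<Rightarrow> 'e list \<Rightarrow> real" where
  "coord_form A c \<alpha> y ws = \<alpha> (coord_inv c y) (map (tvec_of A c (coord_inv c y)) ws)"

definition forms :: "'m topology \<Rightarrow> ('m, 'e::real_inner) chart set \<Rightarrow> nat \<Rightarrow> ('m, 'e) dform set" where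
  "forms M A j = {\<alpha>.
     (\<forall>m. m \<notin> topspace M \<longrightarrow> \<alpha> m = 0) \<and>
     (\<forall>m\<in>topspace M. \<alpha> m \<in> alt_forms j (tangent_space A m)) \<and>
     (\<forall>c\<in>A. \<forall>ws. length ws = j \<longrightarrow> smooth_on (coord_image c) (\<lambda>y. coord_form A c \<alpha> y ws))}"

text \<open>
  The exterior derivative is computed in coordinates by
  \<open>d\<alpha>(w\<^sub>0, \<dots>, w\<^sub>j) = \<Sum>\<^sub>i (-1)\<^sup>i D\<alpha>(w\<^sub>0, \<dots>, w\<^sub>i omitted, \<dots>, w\<^sub>j) w\<^sub>i\<close> with constant \<open>w\<^sub>0, \<dots>, w\<^sub>j\<close>;
  as usual the result does not depend on the chart around \<open>m\<close>.
\<close>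

definition chart_at :: "('m, 'e) chart set \<Rightarrow> 'm \<Rightarrow> ('m, 'e) chart" where
  "chart_at A m = (SOME c. c \<in> A \<and> m \<in> fst c)"

definition ext_deriv :: "'m topology \<Rightarrow> ('m, 'e::real_inner) chart set \<Rightarrow> ('m, 'e) dform \<Rightarrow> ('m, 'e) dform" where
  "ext_deriv M A \<alpha> m us = (if m \<in> topspace M \<and> set us \<subseteq> tangent_space A m then
     (let c = chart_at A m; ws = map (\<lambda>u. u c) us in
       \<Sum>i<length ws. (-1) ^ i *
         frechet_derivative (\<lambda>y. coord_form A c \<alpha> y (remove_nth i ws)) (at (snd c m)) (ws ! i))
     else 0)"

definition interior_prod :: "('m \<Rightarrow> ('m, 'e) tvec) \<Rightarrow> ('m, 'e) dform \<Rightarrow> ('m, 'e) dform" where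
  "interior_prod X \<alpha> = (\<lambda>m us. \<alpha> m (X m # us))"

text \<open>The Lie derivative of forms is given by Cartan's formula \<open>L\<^sub>X = d \<iota>\<^sub>X + \<iota>\<^sub>X d\<close>.\<close>

definition lie_deriv :: "'m topology \<Rightarrow> ('m, 'e::real_inner) chart set \<Rightarrow> ('m \<Rightarrow> ('m, 'e) tvec) \<Rightarrow>
    ('m, 'e) dform \<Rightarrow> ('m, 'e) dform" where
  "lie_deriv M A X \<alpha> = ext_deriv M A (interior_prod X \<alpha>) + interior_prod X (ext_deriv M A \<alpha>)"

definition n_plectic :: "'m topology \<Rightarrow> ('m, 'e::real_inner) chart set \<Rightarrow> nat \<Rightarrow> ('m, 'e) dform \<Rightarrow> bool" where
  "n_plectic M A n \<omega> \<longleftrightarrow> n \<ge> 1 \<and> \<omega> \<in> forms M A (n + 1) \<and> ext_deriv M A \<omega> = 0 \<and>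
     inj_on (\<lambda>(m, u). (m, \<lambda>us. \<omega> m (u # us))) (SIGMA m:topspace M. tangent_space A m)"


section \<open>Actions and moment maps\<close>

definition lie_action :: "'m topology \<Rightarrow> ('m, 'e::real_inner) chart set \<Rightarrow> ('g::real_vector \<Rightarrow> 'g \<Rightarrow> 'g) \<Rightarrow>
    ('g \<Rightarrow> 'm \<Rightarrow> ('m, 'e) tvec) \<Rightarrow> bool" where
  "lie_action M A br v \<longleftrightarrow> linear v \<and> (\<forall>x. v x \<in> vector_fields M A) \<and>
     (\<forall>x y. v (br x y) = vf_bracket A (v x) (v y))"

definition preserves :: "'m topology \<Rightarrow> ('m, 'e::real_inner) chart set \<Rightarrow> ('g \<Rightarrow> 'm \<Rightarrow> ('m, 'e) tvec) \<Rightarrow>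
    ('m, 'e) dform \<Rightarrow> bool" where
  "preserves M A v \<omega> \<longleftrightarrow> (\<forall>x. lie_deriv M A (v x) \<omega> = 0)"

text \<open>The form \<open>\<iota>\<^bsub>v\<^sub>p\<^esub> \<omega>\<close> for \<open>p\<close> in an exterior power; see \<open>contraction_wedge\<close> for decomposable \<open>p\<close>.\<close>

definition contraction :: "('g::real_vector \<Rightarrow> 'm \<Rightarrow> ('m, 'e) tvec) \<Rightarrow> ('m, 'e) dform \<Rightarrow> 'g mvec \<Rightarrow> ('m, 'e) dform" where
  "contraction v \<omega> p = (\<lambda>m us. p (\<lambda>xs. \<omega> m (map (\<lambda>x. v x m) xs @ us)))"

lemma fold_interior_prod:
  "fold (\<lambda>x. interior_prod (v x)) xs \<alpha> m us = \<alpha> m (map (\<lambda>x. v x m) xs @ us)"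
  by (induction xs arbitrary: \<alpha>) (simp_all add: interior_prod_def)

lemma contraction_wedge:
  fixes xs :: "'g::real_vector list"
  assumes act: "lie_action M A br v" and \<omega>: "\<omega> \<in> forms M A j"
  shows "contraction v \<omega> (wedge xs) = fold (\<lambda>x. interior_prod (v x)) xs \<omega>"
proof (intro ext)
  fix m us
  let ?f = "\<lambda>xs. \<omega> m (map (\<lambda>x. v x m) xs @ us)"
  have "wedge xs ?f = ?f xs"
  proof (cases "m \<in> topspace M \<and> set us \<subseteq> tangent_space A m \<and> length xs + length us = j")
    case True
    then have \<omega>m: "\<omega> m \<in> alt_forms j (tangent_space A m)" using \<omega> by (auto simp: forms_def)
    have lin: "v (a *\<^sub>R u + b *\<^sub>R w) m = a *\<^sub>R v u m + b *\<^sub>R v w m" for a b u w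
      using act by (simp add: lie_action_def linear_add linear_scale)
    have vm: "v x m \<in> tangent_space A m" for x
      using act True by (auto simp: lie_action_def vector_fields_def)
    have "?f \<in> alt_forms (length xs) UNIV"
      unfolding alt_forms_UNIV_iff
    proof (intro conjI allI impI)
      fix ys :: "'g list"
      show "?f ys = 0" if "length ys \<noteq> length xs"
        using that True by (intro alt_forms_outside[OF \<omega>m]) auto
      show "?f ys = 0" if "\<not> distinct ys"
        using that by (intro alt_forms_not_distinct[OF \<omega>m]) (auto simp: distinct_map)
      fix i a b u w
      assume i: "i < length ys" and ys: "length ys = length xs"
      let ?zs = "map (\<lambda>x. v x m) ys @ us"
      have upd: "map (\<lambda>x. v x m) (ys[i := t]) @ us = ?zs[i := v t m]" for t
        using i by (simp add: map_update list_update_append)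
      have zs: "length ?zs = j" "set ?zs \<subseteq> tangent_space A m" "i < j"
        using True vm i ys by auto
      show "?f (ys[i := a *\<^sub>R u + b *\<^sub>R w]) = a * ?f (ys[i := u]) + b * ?f (ys[i := w])"
        unfolding upd lin using \<omega>m zs vm unfolding alt_forms_def by blast
    qed
    then show ?thesis by (simp add: wedge_def)
  next
    case False
    have "\<omega> m (zs @ us) = 0" if "length zs = length xs" for zs
    proof (cases "m \<in> topspace M")
      case True
      then have "\<omega> m \<in> alt_forms j (tangent_space A m)" using \<omega> by (simp add: forms_def)
      moreover have "\<not> (length (zs @ us) = j \<and> set (zs @ us) \<subseteq> tangent_space A m)"
        using False True that by auto
      ultimately show ?thesis unfolding alt_forms_def by blast
    qed (use \<omega> in \<open>simp add: forms_def\<close>)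
    then show ?thesis by (simp add: wedge_def)
  qed
  then show "contraction v \<omega> (wedge xs) m us = fold (\<lambda>x. interior_prod (v x)) xs \<omega> m us"
    by (simp add: contraction_def fold_interior_prod)
qed

definition zeta :: "nat \<Rightarrow> real" where
  "zeta k = - ((-1) ^ (k * (k + 1) div 2))"

text \<open>
  For a graded space \<open>D\<close>, the elements of total degree \<open>r\<close> of \<open>D\<^sub>\<ge>\<^sub>1\<^sup>* \<otimes> \<Omega>(M)\<close>: families of linear
  maps \<open>D\<^sub>k \<rightarrow> \<Omega>\<^sup>r\<^sup>-\<^sup>k(M)\<close> for \<open>1 \<le> k \<le> r\<close>, all other components being 0.
\<close>

type_synonym ('g, 'm, 'e) cochain = "nat \<Rightarrow> 'g mvec \<Rightarrow> ('m, 'e) dform"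

definition cochains :: "'m topology \<Rightarrow> ('m, 'e::real_inner) chart set \<Rightarrow> (nat \<Rightarrow> 'g::real_vector mvec set) \<Rightarrow>
    nat \<Rightarrow> ('g, 'm, 'e) cochain set" where
  "cochains M A D r = {\<eta>. (\<forall>k. k \<notin> {1..r} \<longrightarrow> \<eta> k = 0) \<and>
     (\<forall>k\<in>{1..r}. \<eta> k \<in> linear_maps (D k) (forms M A (r - k)))}"

definition homotopy_moment_map :: "'m topology \<Rightarrow> ('m, 'e::real_inner) chart set \<Rightarrow> nat \<Rightarrow> ('m, 'e) dform \<Rightarrow>
    ('g::real_vector \<Rightarrow> 'g \<Rightarrow> 'g) \<Rightarrow> ('g \<Rightarrow> 'm \<Rightarrow> ('m, 'e) tvec) \<Rightarrow> ('g, 'm, 'e) cochain \<Rightarrow> bool" where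
  "homotopy_moment_map M A n \<omega> br v f \<longleftrightarrow> f \<in> cochains M A ext_power n \<and>
     (\<forall>k\<in>{1..n + 1}. \<forall>p\<in>ext_power k.
        - f (k - 1) (boundary br k p) = ext_deriv M A (f k p) + zeta k *\<^sub>R contraction v \<omega> p)"

definition weak_moment_map :: "'m topology \<Rightarrow> ('m, 'e::real_inner) chart set \<Rightarrow> nat \<Rightarrow> ('m, 'e) dform \<Rightarrow>
    ('g::real_vector \<Rightarrow> 'g \<Rightarrow> 'g) \<Rightarrow> ('g \<Rightarrow> 'm \<Rightarrow> ('m, 'e) tvec) \<Rightarrow> ('g, 'm, 'e) cochain \<Rightarrow> bool" where
  "weak_moment_map M A n \<omega> br v f \<longleftrightarrow> f \<in> cochains M A (lie_kernel br) n \<and>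
     (\<forall>k\<in>{1..n}. \<forall>p\<in>lie_kernel br k.
        ext_deriv M A (f k p) = - zeta k *\<^sub>R contraction v \<omega> p)"

definition equivariant :: "'m topology \<Rightarrow> ('m, 'e::real_inner) chart set \<Rightarrow> nat \<Rightarrow>
    ('g::real_vector \<Rightarrow> 'g \<Rightarrow> 'g) \<Rightarrow> ('g \<Rightarrow> 'm \<Rightarrow> ('m, 'e) tvec) \<Rightarrow> (nat \<Rightarrow> 'g mvec set) \<Rightarrow>
    ('g, 'm, 'e) cochain \<Rightarrow> bool" where
  "equivariant M A n br v D f \<longleftrightarrow>
     (\<forall>x. \<forall>k\<in>{1..n}. \<forall>p\<in>D k. f k (ad br k x p) = lie_deriv M A (v x) (f k p))"


section \<open>The total complexes\<close>

definition de_rham_part :: "'m topology \<Rightarrow> ('m, 'e::real_inner) chart set \<Rightarrow> (nat \<Rightarrow> 'g::real_vector mvec set) \<Rightarrow>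
    ('g, 'm, 'e) cochain \<Rightarrow> ('g, 'm, 'e) cochain" where
  "de_rham_part M A D \<eta> k p = (if k \<ge> 1 \<and> p \<in> D k then (-1) ^ k *\<^sub>R ext_deriv M A (\<eta> k p) else 0)"

definition ce_part :: "('g::real_vector \<Rightarrow> 'g \<Rightarrow> 'g) \<Rightarrow> ('g, 'm, 'e) cochain \<Rightarrow> ('g, 'm, 'e) cochain" where
  "ce_part br \<eta> k p = (if k \<ge> 1 \<and> p \<in> ext_power k then \<eta> (k - 1) (boundary br k p) else 0)"

definition d_tilde :: "'m topology \<Rightarrow> ('m, 'e::real_inner) chart set \<Rightarrow> ('g::real_vector \<Rightarrow> 'g \<Rightarrow> 'g) \<Rightarrow>
    ('g, 'm, 'e) cochain \<Rightarrow> ('g, 'm, 'e) cochain" where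
  "d_tilde M A br \<eta> = ce_part br \<eta> + de_rham_part M A ext_power \<eta>"

definition d_hat :: "'m topology \<Rightarrow> ('m, 'e::real_inner) chart set \<Rightarrow> ('g::real_vector \<Rightarrow> 'g \<Rightarrow> 'g) \<Rightarrow>
    ('g, 'm, 'e) cochain \<Rightarrow> ('g, 'm, 'e) cochain" where
  "d_hat M A br = de_rham_part M A (lie_kernel br)"

definition act_cochain :: "'m topology \<Rightarrow> ('m, 'e::real_inner) chart set \<Rightarrow> ('g::real_vector \<Rightarrow> 'g \<Rightarrow> 'g) \<Rightarrow>
    ('g \<Rightarrow> 'm \<Rightarrow> ('m, 'e) tvec) \<Rightarrow> (nat \<Rightarrow> 'g mvec set) \<Rightarrow> 'g \<Rightarrow>
    ('g, 'm, 'e) cochain \<Rightarrow> ('g, 'm, 'e) cochain" where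
  "act_cochain M A br v D x \<eta> k p = (if k \<ge> 1 \<and> p \<in> D k
     then lie_deriv M A (v x) (\<eta> k p) - \<eta> k (ad br k x p) else 0)"

definition inv_cochains :: "'m topology \<Rightarrow> ('m, 'e::real_inner) chart set \<Rightarrow> ('g::real_vector \<Rightarrow> 'g \<Rightarrow> 'g) \<Rightarrow>
    ('g \<Rightarrow> 'm \<Rightarrow> ('m, 'e) tvec) \<Rightarrow> (nat \<Rightarrow> 'g mvec set) \<Rightarrow> nat \<Rightarrow> ('g, 'm, 'e) cochain set" where
  "inv_cochains M A br v D r = {\<eta> \<in> cochains M A D r. \<forall>x. act_cochain M A br v D x \<eta> = 0}"

definition omega_tilde :: "nat \<Rightarrow> ('m, 'e) dform \<Rightarrow> ('g::real_vector \<Rightarrow> 'm \<Rightarrow> ('m, 'e) tvec) \<Rightarrow>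
    ('g, 'm, 'e::real_inner) cochain" where
  "omega_tilde n \<omega> v k p = (if k \<in> {1..n + 1} \<and> p \<in> ext_power k
     then (-1) ^ (k - 1) *\<^sub>R contraction v \<omega> p else 0)"

definition omega_hat :: "nat \<Rightarrow> ('m, 'e) dform \<Rightarrow> ('g::real_vector \<Rightarrow> 'g \<Rightarrow> 'g) \<Rightarrow>
    ('g \<Rightarrow> 'm \<Rightarrow> ('m, 'e) tvec) \<Rightarrow> ('g, 'm, 'e::real_inner) cochain" where
  "omega_hat n \<omega> br v k p = (if k \<in> {1..n} \<and> p \<in> lie_kernel br k
     then (-1) ^ (k - 1) *\<^sub>R contraction v \<omega> p else 0)"

text \<open>
  Cohomology of a cochain complex with homogeneous parts \<open>C r\<close> and differential \<open>d\<close>, as the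
  quotient of the additive group of cocycles; its zero element is written \<open>\<one>\<close>.
\<close>

definition cocycles :: "(nat \<Rightarrow> 'c::ab_group_add set) \<Rightarrow> ('c \<Rightarrow> 'c) \<Rightarrow> nat \<Rightarrow> 'c monoid" where
  "cocycles C d r = \<lparr>carrier = {c \<in> C r. d c = 0}, mult = (+), one = 0\<rparr>"

definition coboundaries :: "(nat \<Rightarrow> 'c::ab_group_add set) \<Rightarrow> ('c \<Rightarrow> 'c) \<Rightarrow> nat \<Rightarrow> 'c set" where
  "coboundaries C d r = (if r = 0 then {0} else d ` C (r - 1))"

definition cohomology :: "(nat \<Rightarrow> 'c::ab_group_add set) \<Rightarrow> ('c \<Rightarrow> 'c) \<Rightarrow> nat \<Rightarrow> 'c set monoid" where
  "cohomology C d r = cocycles C d r Mod coboundaries C d r"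

definition cohomology_class :: "(nat \<Rightarrow> 'c::ab_group_add set) \<Rightarrow> ('c \<Rightarrow> 'c) \<Rightarrow> nat \<Rightarrow> 'c \<Rightarrow> 'c set" where
  "cohomology_class C d r c = coboundaries C d r #>\<^bsub>cocycles C d r\<^esub> c"

end

theory Submission
  imports Defs
begin

text \<open>
  With \<open>f\<^sub>k = \<zeta>(k) \<alpha>\<^sub>k\<close> the equations of a moment map become, degree by degree, the components of
  \<open>d\<^sub>t\<^sub>o\<^sub>t \<alpha> = \<omega>\<close>, because \<open>\<zeta>(k)\<^sup>2 = 1\<close> and \<open>\<zeta>(k) \<zeta>(k - 1) = (-1)\<^sup>k\<close>. The class of \<open>\<omega>\<close> vanishes
  iff \<open>\<omega>\<close> has a potential, which only uses that the differential is additive on invariant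
  cochains. The analytic input is the linearity of the exterior and the Lie derivative on
  smooth forms: frechet derivatives are additive only where they exist, so the interior product of
  a form with a vector field has to be shown differentiable in coordinates.
\<close>

section \<open>Smooth functions on open sets\<close>

text \<open>\<open>frechet_derivative\<close> is a choice among the derivatives of a function.
  Functions agreeing near \<open>x\<close> have the same derivatives there, so the choice agrees as
  well, even where none exists.\<close>

lemma frechet_derivative_cong_open:
  assumes "open S" "x \<in> S" "\<And>y. y \<in> S \<Longrightarrow> f y = g y"
  shows "frechet_derivative f (at x) = frechet_derivative g (at x)"
proof -
  have "(f has_derivative D) (at x) \<longleftrightarrow> (g has_derivative D) (at x)" for D
    using assms by (metis has_derivative_transform_within_open)
  then show ?thesis by (simp add: frechet_derivative_def)
qed

lemma differentiable_cong_open: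
  assumes "open S" "x \<in> S" "\<And>y. y \<in> S \<Longrightarrow> f y = g y" "f differentiable (at x)"
  shows "g differentiable (at x)"
  using assms unfolding differentiable_def by (metis has_derivative_transform_within_open)

text \<open>Formulas for derivatives hold only on \<open>S\<close>, whereas \<open>ck_on\<close>
  speaks of globally defined functions; this bridges the gap. The induction varies \<open>f\<close>
  and \<open>g\<close> because its step passes to directional derivatives.\<close>

lemma ck_on_cong_open:
  assumes "open S" "\<And>x. x \<in> S \<Longrightarrow> f x = g x" "ck_on k S f"
  shows "ck_on k S g"
  using assms(2,3)
proof (induction k arbitrary: f g)
  case 0
  then show ?case by (simp cong: continuous_on_cong)
next
  case (Suc k)
  have eq: "frechet_derivative f (at x) = frechet_derivative g (at x)" if "x \<in> S" for x
    using frechet_derivative_cong_open[OF assms(1) that] Suc.prems(1) by blast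
  have "ck_on k S (\<lambda>x. frechet_derivative g (at x) w)" for w
    by (rule Suc.IH[of "\<lambda>x. frechet_derivative f (at x) w"]) (use Suc.prems(2) eq in simp_all)
  moreover have "g differentiable (at x)" if "x \<in> S" for x
    by (rule differentiable_cong_open[OF assms(1) that Suc.prems(1)]) (use Suc.prems(2) that in simp_all)
  ultimately show ?case by simp
qed

lemma frechet_derivative_lincomb:
  fixes f g :: "'a::real_normed_vector \<Rightarrow> 'b::real_normed_vector"
  assumes "f differentiable (at x)" "g differentiable (at x)"
  shows "frechet_derivative (\<lambda>y. a *\<^sub>R f y + b *\<^sub>R g y) (at x) w =
    a *\<^sub>R frechet_derivative f (at x) w + b *\<^sub>R frechet_derivative g (at x) w"
proof -
  have "((\<lambda>y. a *\<^sub>R f y + b *\<^sub>R g y) has_derivative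
     (\<lambda>w. a *\<^sub>R frechet_derivative f (at x) w + b *\<^sub>R frechet_derivative g (at x) w)) (at x)"
    using assms unfolding frechet_derivative_works
    by (intro has_derivative_add has_derivative_scaleR_right)
  from frechet_derivative_at[OF this] show ?thesis by metis
qed

lemma ck_on_lincomb:
  assumes "open S" "ck_on k S f" "ck_on k S g"
  shows "ck_on k S (\<lambda>x. a *\<^sub>R f x + b *\<^sub>R g x)"
  using assms(2,3)
proof (induction k arbitrary: f g)
  case 0
  then show ?case by (auto intro!: continuous_intros)
next
  case (Suc k)
  have "ck_on k S (\<lambda>x. frechet_derivative (\<lambda>y. a *\<^sub>R f y + b *\<^sub>R g y) (at x) w)" for w
  \<comment> \<open>The formula for the derivative of the combination is available only at points of
    \<open>S\<close>.\<close>
  proof (rule ck_on_cong_open[OF assms(1)])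
    show "ck_on k S (\<lambda>x. a *\<^sub>R frechet_derivative f (at x) w + b *\<^sub>R frechet_derivative g (at x) w)"
      using Suc by simp
  qed (use Suc.prems in \<open>simp add: frechet_derivative_lincomb\<close>)
  then show ?case using Suc.prems by auto
qed

lemma smooth_on_lincomb:
  "open S \<Longrightarrow> smooth_on S f \<Longrightarrow> smooth_on S g \<Longrightarrow> smooth_on S (\<lambda>x. a *\<^sub>R f x + b *\<^sub>R g x)"
  by (simp add: smooth_on_def ck_on_lincomb)

lemma smooth_on_0: "smooth_on (S :: 'a::real_normed_vector set) (\<lambda>x. 0 :: 'b::real_normed_vector)"
proof -
  have "ck_on k S (\<lambda>x. 0 :: 'b)" for k
    by (induction k) (simp_all add: frechet_derivative_const)
  then show ?thesis by (simp add: smooth_on_def)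
qed

lemma smooth_on_differentiable: "smooth_on S f \<Longrightarrow> x \<in> S \<Longrightarrow> f differentiable (at x)"
  unfolding smooth_on_def by (metis ck_on.simps(2))

section \<open>Charts and tangent vectors\<close>

text \<open>A homeomorphism onto an open set is an open map into the model space. For
  \<open>V\<close> another chart domain, this makes the domain of the coordinate change
  open.\<close>

lemma chart_open_image:
  assumes "smooth_manifold M A" "c \<in> A" "openin M V"
  shows "open (snd c ` (fst c \<inter> V))"
proof -
  have hom: "homeomorphic_map (subtopology M (fst c)) (top_of_set (coord_image c)) (snd c)"
    and op: "open (coord_image c)"
    using assms by (auto simp: smooth_manifold_def)
  have "openin (subtopology M (fst c)) (fst c \<inter> V)"
    using assms(3) by (auto simp: openin_subtopology)
  then have "openin (top_of_set (coord_image c)) (snd c ` (fst c \<inter> V))"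
    using homeomorphic_imp_open_map[OF hom] by (auto simp: open_map_def)
  then show ?thesis using op openin_open_eq by blast
qed

lemma chart_inj:
  assumes "smooth_manifold M A" "c \<in> A"
  shows "inj_on (snd c) (fst c)"
proof -
  have hom: "homeomorphic_map (subtopology M (fst c)) (top_of_set (coord_image c)) (snd c)"
    and dom: "openin M (fst c)"
    using assms by (auto simp: smooth_manifold_def)
  have "topspace (subtopology M (fst c)) = fst c"
    using openin_subset[OF dom] by auto
  then show ?thesis
    using homeomorphic_imp_injective_map[OF hom] by simp
qed

lemma coord_inv_chart:
  assumes "smooth_manifold M A" "c \<in> A" "m \<in> fst c"
  shows "coord_inv c (snd c m) = m"
  using chart_inj[OF assms(1,2)] assms(3) by (simp add: coord_inv_def)

lemma coord_inv_in:
  assumes "y \<in> coord_image c"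
  shows "coord_inv c y \<in> fst c" "snd c (coord_inv c y) = y"
  using assms by (auto simp: coord_inv_def coord_image_def inv_into_into f_inv_into_f)

lemma chart_domain_subset:
  assumes "smooth_manifold M A" "c \<in> A"
  shows "fst c \<subseteq> topspace M"
  using assms by (auto simp: smooth_manifold_def)

lemma transition_differentiable:
  assumes "smooth_manifold M A" "c \<in> A" "c' \<in> A" "m \<in> fst c" "m \<in> fst c'"
  shows "(snd c' \<circ> coord_inv c) differentiable (at (snd c m))"
proof (rule smooth_on_differentiable)
  show "smooth_on (snd c ` (fst c \<inter> fst c')) (snd c' \<circ> coord_inv c)"
    using assms by (auto simp: smooth_manifold_def)
qed (use assms in auto)

lemma coord_change_linear:
  assumes "smooth_manifold M A" "c \<in> A" "c' \<in> A" "m \<in> fst c" "m \<in> fst c'"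
  shows "linear (coord_change c c' m)"
  unfolding coord_change_def by (rule linear_frechet_derivative[OF transition_differentiable[OF assms]])

text \<open>The chain rule at \<open>snd c m\<close>. The composite through \<open>c'\<close> agrees
  with the direct coordinate change only on the image of the overlap of \<open>c\<close> and
  \<open>c'\<close>, an open set, which suffices for derivatives.\<close>

lemma coord_change_trans:
  assumes man: "smooth_manifold M A" and c: "c \<in> A" "c' \<in> A" "c'' \<in> A"
    and m: "m \<in> fst c" "m \<in> fst c'" "m \<in> fst c''"
  shows "coord_change c' c'' m (coord_change c c' m w) = coord_change c c'' m w"
proof -
  let ?f = "snd c' \<circ> coord_inv c" and ?g = "snd c'' \<circ> coord_inv c'"
  let ?U = "snd c ` (fst c \<inter> fst c')"
  have fm: "?f (snd c m) = snd c' m" by (simp add: coord_inv_chart[OF man c(1) m(1)])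
  have df: "(?f has_derivative coord_change c c' m) (at (snd c m))"
    using transition_differentiable[OF man c(1,2) m(1,2)]
    by (simp add: coord_change_def frechet_derivative_works)
  have dg: "(?g has_derivative coord_change c' c'' m) (at (?f (snd c m)))"
    using transition_differentiable[OF man c(2,3) m(2,3)] unfolding fm
    by (simp add: coord_change_def frechet_derivative_works)
  have "((?g \<circ> ?f) has_derivative (coord_change c' c'' m \<circ> coord_change c c' m)) (at (snd c m))"
    by (rule diff_chain_at[OF df dg])
  moreover have "frechet_derivative (?g \<circ> ?f) (at (snd c m)) =
      frechet_derivative (snd c'' \<circ> coord_inv c) (at (snd c m))"
  proof (rule frechet_derivative_cong_open[of ?U])
    show "open ?U"
      using man c(2) by (intro chart_open_image[OF man c(1)]) (auto simp: smooth_manifold_def)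
    show "snd c m \<in> ?U" using m by blast
    show "(?g \<circ> ?f) y = (snd c'' \<circ> coord_inv c) y" if "y \<in> ?U" for y
      using that coord_inv_chart[OF man c(1)] coord_inv_chart[OF man c(2)] by auto
  qed
  ultimately have "coord_change c c'' m = coord_change c' c'' m \<circ> coord_change c c' m"
    unfolding coord_change_def by (metis frechet_derivative_at)
  then show ?thesis by simp
qed

section \<open>Tangent vectors determined by one chart\<close>

lemma tvec_of_in_tangent_space:
  assumes "smooth_manifold M A" "c \<in> A" "m \<in> fst c"
  shows "tvec_of A c m w \<in> tangent_space A m"
  using assms by (auto simp: tangent_space_def tvec_of_def coord_change_trans)

text \<open>Compatibility under coordinate changes lets one chart determine all coordinates. This is
  what brings the values of a vector field into a coordinate expression.\<close>

lemma tvec_of_coord: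
  assumes "X \<in> tangent_space A m" "c \<in> A" "m \<in> fst c"
  shows "tvec_of A c m (X c) = X"
proof
  fix c'
  have "X c' = (if c' \<in> A \<and> m \<in> fst c' then coord_change c c' m (X c) else 0)"
  proof (cases "c' \<in> A \<and> m \<in> fst c'")
    case True
    then have "c' \<in> A" "m \<in> fst c \<inter> fst c'" using assms(3) by auto
    moreover have "\<forall>c\<in>A. \<forall>c'\<in>A. m \<in> fst c \<inter> fst c' \<longrightarrow> X c' = coord_change c c' m (X c)"
      using assms(1) unfolding tangent_space_def mem_Collect_eq by (rule conjunct2)
    ultimately have "X c' = coord_change c c' m (X c)" using assms(2) by blast
    then show ?thesis using True by simp
  next
    case False
    moreover have "\<forall>c. \<not> (c \<in> A \<and> m \<in> fst c) \<longrightarrow> X c = 0"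
      using assms(1) unfolding tangent_space_def mem_Collect_eq by (rule conjunct1)
    ultimately have "X c' = 0" by blast
    then show ?thesis by (simp only: if_not_P[OF False])
  qed
  then show "tvec_of A c m (X c) c' = X c'" by (simp add: tvec_of_def)
qed

lemma tvec_of_lincomb:
  assumes "smooth_manifold M A" "c \<in> A" "m \<in> fst c"
  shows "tvec_of A c m (a *\<^sub>R u + b *\<^sub>R w) = a *\<^sub>R tvec_of A c m u + b *\<^sub>R tvec_of A c m w"
  using coord_change_linear[OF assms(1,2) _ assms(3)]
  by (auto simp: tvec_of_def fun_eq_iff linear_add linear_scale)

section \<open>Linearity of the derivatives of forms\<close>

lemma alt_forms_lincomb:
  assumes "\<xi> \<in> alt_forms k V" "\<eta> \<in> alt_forms k V"
  shows "a *\<^sub>R \<xi> + b *\<^sub>R \<eta> \<in> alt_forms k V"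
proof -
  have eq: "(a *\<^sub>R \<xi> + b *\<^sub>R \<eta>) xs = a * \<xi> xs + b * \<eta> xs" for xs by simp
  show ?thesis
    using assms unfolding alt_forms_def mem_Collect_eq eq
    by (intro conjI allI impI) (simp_all add: algebra_simps)
qed

lemma coord_form_lincomb:
  "coord_form A c (a *\<^sub>R \<alpha> + b *\<^sub>R \<beta>) y ws =
    a *\<^sub>R coord_form A c \<alpha> y ws + b *\<^sub>R coord_form A c \<beta> y ws"
  by (simp add: coord_form_def)

lemma forms_lincomb:
  assumes "smooth_manifold M A" "\<alpha> \<in> forms M A j" "\<beta> \<in> forms M A j"
  shows "a *\<^sub>R \<alpha> + b *\<^sub>R \<beta> \<in> forms M A j"
proof -
  have op: "open (coord_image c)" if "c \<in> A" for c
    using assms(1) that by (auto simp: smooth_manifold_def)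
  have eq: "(a *\<^sub>R \<alpha> + b *\<^sub>R \<beta>) m = a *\<^sub>R \<alpha> m + b *\<^sub>R \<beta> m" for m by simp
  show ?thesis
    using assms(2,3) unfolding forms_def mem_Collect_eq eq coord_form_lincomb
    by (auto intro!: alt_forms_lincomb smooth_on_lincomb op simp del: real_scaleR_def)
qed

lemma forms_0: "0 \<in> forms M A j"
  by (simp add: forms_def alt_forms_def coord_form_def smooth_on_0)

text \<open>\<open>ext_deriv\<close> differentiates coordinate expressions once, so this is all that
  its linearity asks for, and it is easier to check for interior products than membership in
  \<open>forms\<close>. The list \<open>ws\<close> has any length because \<open>ext_deriv\<close>
  is not told the degree.\<close>

definition coord_differentiable :: "('m, 'e::real_inner) chart set \<Rightarrow> ('m, 'e) dform \<Rightarrow> bool" where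
  "coord_differentiable A \<alpha> \<longleftrightarrow> (\<forall>c\<in>A. \<forall>y\<in>coord_image c. \<forall>ws.
     (\<lambda>y. coord_form A c \<alpha> y ws) differentiable (at y))"

lemma ext_deriv_lincomb:
  assumes man: "smooth_manifold M A" and "coord_differentiable A \<alpha>" "coord_differentiable A \<beta>"
  shows "ext_deriv M A (a *\<^sub>R \<alpha> + b *\<^sub>R \<beta>) = a *\<^sub>R ext_deriv M A \<alpha> + b *\<^sub>R ext_deriv M A \<beta>"
proof (intro ext)
  fix m us
  show "ext_deriv M A (a *\<^sub>R \<alpha> + b *\<^sub>R \<beta>) m us = (a *\<^sub>R ext_deriv M A \<alpha> + b *\<^sub>R ext_deriv M A \<beta>) m us"
  proof (cases "m \<in> topspace M")
    case True
    define c where "c = chart_at A m"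
    \<comment> \<open>The charts cover M, so the choice in \<open>chart_at\<close> does give a chart
      around \<open>m\<close>.\<close>
    have "\<exists>c. c \<in> A \<and> m \<in> fst c" using True man unfolding smooth_manifold_def by blast
    from someI_ex[OF this] have c: "c \<in> A" "m \<in> fst c" by (simp_all add: c_def chart_at_def)
    then have "snd c m \<in> coord_image c" by (simp add: coord_image_def)
    then have "frechet_derivative (\<lambda>y. coord_form A c (a *\<^sub>R \<alpha> + b *\<^sub>R \<beta>) y ws) (at (snd c m)) w =
        a * frechet_derivative (\<lambda>y. coord_form A c \<alpha> y ws) (at (snd c m)) w +
        b * frechet_derivative (\<lambda>y. coord_form A c \<beta> y ws) (at (snd c m)) w" for ws w
      using c assms unfolding coord_form_lincomb coord_differentiable_def
      by (subst frechet_derivative_lincomb) auto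
    then show ?thesis
      by (simp add: ext_deriv_def Let_def c_def[symmetric] sum_distrib_left
          sum.distrib[symmetric] algebra_simps)
  qed (simp add: ext_deriv_def)
qed

lemma coord_form_outside:
  assumes "smooth_manifold M A" "\<alpha> \<in> forms M A j" "c \<in> A" "y \<in> coord_image c" "length ws \<noteq> j"
  shows "coord_form A c \<alpha> y ws = 0"
proof -
  have "coord_inv c y \<in> topspace M"
    using coord_inv_in[OF assms(4)] chart_domain_subset[OF assms(1,3)] by auto
  then have "\<alpha> (coord_inv c y) \<in> alt_forms j (tangent_space A (coord_inv c y))"
    using assms(2) by (auto simp: forms_def)
  then show ?thesis using assms(5) unfolding coord_form_def by (intro alt_forms_outside) auto
qed

lemma forms_coord_differentiable:
  assumes man: "smooth_manifold M A" and \<alpha>: "\<alpha> \<in> forms M A j"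
  shows "coord_differentiable A \<alpha>"
  unfolding coord_differentiable_def
proof (intro ballI allI)
  fix c y ws assume c: "c \<in> A" and y: "y \<in> coord_image c"
  show "(\<lambda>y. coord_form A c \<alpha> y ws) differentiable (at y)"
  proof (cases "length ws = j")
    case True
    then show ?thesis using \<alpha> c y by (intro smooth_on_differentiable) (auto simp: forms_def)
  next
    case False
    \<comment> \<open>On lists of the wrong length the expression is 0 throughout the coordinate
      image, so it is compared with the constant 0.\<close>
    have "open (coord_image c)" using man c by (auto simp: smooth_manifold_def)
    then show ?thesis using y
      by (rule differentiable_cong_open[where f = "\<lambda>y. 0"])
        (auto simp: coord_form_outside[OF man \<alpha> c _ False])
  qed
qed

lemma coord_form_linear_hd:
  assumes man: "smooth_manifold M A" and \<alpha>: "\<alpha> \<in> forms M A j" and c: "c \<in> A" and y: "y \<in> coord_image c"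
  shows "linear (\<lambda>w. coord_form A c \<alpha> y (w # ws))"
proof (cases "Suc (length ws) = j")
  case True
  let ?m = "coord_inv c y"
  note m = coord_inv_in(1)[OF y]
  have \<alpha>m: "\<alpha> ?m \<in> alt_forms j (tangent_space A ?m)"
    using \<alpha> m chart_domain_subset[OF man c] by (auto simp: forms_def)
  have "coord_form A c \<alpha> y ((a *\<^sub>R u + b *\<^sub>R w) # ws) =
      a * coord_form A c \<alpha> y (u # ws) + b * coord_form A c \<alpha> y (w # ws)" for a b u w
  proof -
    \<comment> \<open>The leading 0 is a placeholder: multilinearity in \<open>alt_forms\<close> is
      phrased by list updates, here of slot 0.\<close>
    let ?xs = "map (tvec_of A c ?m) (0 # ws)"
    have "length ?xs = j" "set ?xs \<subseteq> tangent_space A ?m" "0 < j"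
      using True by (auto simp: tvec_of_in_tangent_space[OF man c m])
    then have "\<alpha> ?m (?xs[0 := a *\<^sub>R tvec_of A c ?m u + b *\<^sub>R tvec_of A c ?m w]) =
       a * \<alpha> ?m (?xs[0 := tvec_of A c ?m u]) + b * \<alpha> ?m (?xs[0 := tvec_of A c ?m w])"
      using \<alpha>m tvec_of_in_tangent_space[OF man c m] unfolding alt_forms_def by blast
    then show ?thesis by (simp add: coord_form_def tvec_of_lincomb[OF man c m])
  qed
  from this[where a = 1 and b = 1] this[where b = 0] show ?thesis
    by (intro linearI) simp_all
qed (simp add: coord_form_outside[OF man \<alpha> c y] linear_zero)

section \<open>Differentiability of interior products\<close>

text \<open>Gram-Schmidt gives a finite orthogonal spanning set. What remains of \<open>x\<close>
  after subtracting its projections is orthogonal to the span, hence to itself, hence 0.\<close>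

lemma finite_dim_orthogonal_expansion:
  assumes "finite_dim TYPE('e::real_inner)"
  obtains B :: "'e::real_inner set" where "finite B" "\<And>x. x = (\<Sum>b\<in>B. (b \<bullet> x / (b \<bullet> b)) *\<^sub>R b)"
proof -
  obtain B0 :: "'e set" where B0: "finite B0" "span B0 = UNIV" using assms by (auto simp: finite_dim_def)
  obtain B :: "'e set" where B: "finite B" "span B = UNIV" "pairwise orthogonal B"
    using basis_orthogonal[OF B0(1)] B0(2) by auto
  have "x = (\<Sum>b\<in>B. (b \<bullet> x / (b \<bullet> b)) *\<^sub>R b)" for x
  proof -
    define r where "r = x - (\<Sum>b\<in>B. (b \<bullet> x / (b \<bullet> b)) *\<^sub>R b)"
    have "orthogonal r b" if b: "b \<in> B" for b
    proof -
      \<comment> \<open>Orthogonality removes the terms with \<open>c\<close> different from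
        \<open>b\<close>; at \<open>c = b\<close> the denominator cancels, or \<open>b = 0\<close>
        and both sides are 0.\<close>
      have "(\<Sum>c\<in>B. (c \<bullet> x / (c \<bullet> c)) * (b \<bullet> c)) = (\<Sum>c\<in>B. if c = b then b \<bullet> x else 0)"
        using B(3) b by (intro sum.cong) (auto simp: pairwise_def orthogonal_def)
      then have "b \<bullet> r = 0"
        using B(1) b by (simp add: r_def inner_diff_right inner_sum_right)
      then show ?thesis by (simp add: orthogonal_def inner_commute)
    qed
    then have "orthogonal r r" using orthogonal_to_span[of r B r] B(2) by simp
    then have "r = 0" by (simp add: orthogonal_self)
    then show ?thesis by (simp add: r_def)
  qed
  with B(1) show ?thesis by (rule that)
qed

text \<open>In coordinates the first argument of the form varies with the point. Expanding it in a
  fixed spanning set gives a finite sum of products: coefficients of \<open>X\<close> times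
  coordinate expressions of \<alpha> with constant arguments.\<close>

lemma interior_prod_coord_differentiable:
  fixes A :: "('m, 'e::real_inner) chart set"
  assumes man: "smooth_manifold M A" and X: "X \<in> vector_fields M A" and \<alpha>: "\<alpha> \<in> forms M A j"
  shows "coord_differentiable A (interior_prod X \<alpha>)"
  unfolding coord_differentiable_def
proof (intro ballI allI)
  fix c y ws assume c: "c \<in> A" and y: "y \<in> coord_image c"
  obtain B :: "'e set" where B: "finite B" "\<And>x. x = (\<Sum>b\<in>B. (b \<bullet> x / (b \<bullet> b)) *\<^sub>R b)"
    using man finite_dim_orthogonal_expansion[where 'e = 'e] unfolding smooth_manifold_def by blast
  define X' where "X' y = X (coord_inv c y) c" for y
  have X': "X' differentiable (at y)"
    using X c y unfolding X'_def by (intro smooth_on_differentiable) (auto simp: vector_fields_def)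
  have op: "open (coord_image c)" using man c by (auto simp: smooth_manifold_def)
  let ?h = "\<lambda>y. \<Sum>b\<in>B. (b \<bullet> X' y / (b \<bullet> b)) * coord_form A c \<alpha> y (b # ws)"
  show "(\<lambda>y. coord_form A c (interior_prod X \<alpha>) y ws) differentiable (at y)"
  proof (rule differentiable_cong_open[OF op y, of ?h])
    fix z assume z: "z \<in> coord_image c"
    note m = coord_inv_in(1)[OF z] and lin = coord_form_linear_hd[OF man \<alpha> c z, of ws]
    have "X (coord_inv c z) \<in> tangent_space A (coord_inv c z)"
      using X m chart_domain_subset[OF man c] by (auto simp: vector_fields_def)
    \<comment> \<open>By \<open>tvec_of_coord\<close>, the vector of \<open>X\<close> is the one
      with coordinates \<open>X' z\<close> in \<open>c\<close>, so it can join the argument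
      list.\<close>
    then have "coord_form A c (interior_prod X \<alpha>) z ws = coord_form A c \<alpha> z (X' z # ws)"
      by (simp add: coord_form_def interior_prod_def X'_def tvec_of_coord[OF _ c m])
    also have "\<dots> = coord_form A c \<alpha> z ((\<Sum>b\<in>B. (b \<bullet> X' z / (b \<bullet> b)) *\<^sub>R b) # ws)"
      using B(2)[of "X' z"] by simp
    also have "\<dots> = ?h z"
      by (simp only: linear_sum[OF lin] linear_scale[OF lin] real_scaleR_def)
    finally show "?h z = coord_form A c (interior_prod X \<alpha>) z ws" by simp
  next
    have "(\<lambda>y. coord_form A c \<alpha> y (b # ws)) differentiable (at y)" for b
      using forms_coord_differentiable[OF man \<alpha>] c y by (simp add: coord_differentiable_def)
    moreover have "(\<lambda>y. b \<bullet> X' y / (b \<bullet> b)) differentiable (at y)" for b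
    proof -
      obtain D where "(X' has_derivative D) (at y)" using X' by (auto simp: differentiable_def)
      then have "((\<lambda>y. inverse (b \<bullet> b) * (b \<bullet> X' y)) has_derivative (\<lambda>h. inverse (b \<bullet> b) * (b \<bullet> D h))) (at y)"
        by (intro has_derivative_mult_right has_derivative_inner_right)
      then show ?thesis by (auto simp: differentiable_def divide_inverse mult.commute)
    qed
    ultimately show "?h differentiable (at y)"
      using B(1) by (auto intro!: differentiable_sum differentiable_mult simp del: times_divide_eq_left)
  qed
qed

section \<open>Exterior and Lie derivative as linear operators on forms\<close>

lemma ext_deriv_forms_lincomb:
  assumes "smooth_manifold M A" "\<alpha> \<in> forms M A j" "\<beta> \<in> forms M A j"
  shows "ext_deriv M A (a *\<^sub>R \<alpha> + b *\<^sub>R \<beta>) = a *\<^sub>R ext_deriv M A \<alpha> + b *\<^sub>R ext_deriv M A \<beta>"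
  using assms by (intro ext_deriv_lincomb forms_coord_differentiable)

text \<open>In Cartan's formula the interior product is linear pointwise. The delicate term is the
  exterior derivative of an interior product, covered by
  \<open>interior_prod_coord_differentiable\<close>.\<close>

lemma lie_deriv_forms_lincomb:
  assumes "smooth_manifold M A" "X \<in> vector_fields M A" "\<alpha> \<in> forms M A j" "\<beta> \<in> forms M A j"
  shows "lie_deriv M A X (a *\<^sub>R \<alpha> + b *\<^sub>R \<beta>) = a *\<^sub>R lie_deriv M A X \<alpha> + b *\<^sub>R lie_deriv M A X \<beta>"
proof -
  have lin: "interior_prod X (a *\<^sub>R \<gamma> + b *\<^sub>R \<delta>) = a *\<^sub>R interior_prod X \<gamma> + b *\<^sub>R interior_prod X \<delta>" for \<gamma> \<delta>
    by (simp add: interior_prod_def fun_eq_iff)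
  show ?thesis
    unfolding lie_deriv_def ext_deriv_forms_lincomb[OF assms(1,3,4)] lin
    by (subst ext_deriv_lincomb)
      (use assms in \<open>auto intro: interior_prod_coord_differentiable simp: algebra_simps\<close>)
qed

lemma ext_deriv_scaleR:
  "smooth_manifold M A \<Longrightarrow> \<alpha> \<in> forms M A j \<Longrightarrow> ext_deriv M A (a *\<^sub>R \<alpha>) = a *\<^sub>R ext_deriv M A \<alpha>"
  using ext_deriv_forms_lincomb[of M A \<alpha> j 0 a 0] by (simp add: forms_0)

lemma lie_deriv_scaleR:
  "smooth_manifold M A \<Longrightarrow> X \<in> vector_fields M A \<Longrightarrow> \<alpha> \<in> forms M A j \<Longrightarrow>
    lie_deriv M A X (a *\<^sub>R \<alpha>) = a *\<^sub>R lie_deriv M A X \<alpha>"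
  using lie_deriv_forms_lincomb[of M A X \<alpha> j 0 a 0] by (simp add: forms_0)

lemma ext_deriv_0: "smooth_manifold M A \<Longrightarrow> ext_deriv M A 0 = 0"
  using ext_deriv_scaleR[OF _ forms_0, of M A 0] by simp

lemma lie_deriv_0: "smooth_manifold M A \<Longrightarrow> X \<in> vector_fields M A \<Longrightarrow> lie_deriv M A X 0 = 0"
  using lie_deriv_scaleR[OF _ _ forms_0, of M A X 0] by simp

section \<open>Cochains and moment maps\<close>

text \<open>Outside \<open>{1..r}\<close> the component is 0, which is a form of every degree, so
  the truncated subtraction \<open>r - k\<close> does no harm.\<close>

lemma cochains_apply_in_forms:
  assumes "\<eta> \<in> cochains M A D r" "p \<in> D k"
  shows "\<eta> k p \<in> forms M A (r - k)"
  using assms by (cases "k \<in> {1..r}") (auto simp: cochains_def linear_maps_def forms_0 image_subset_iff)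

lemma linear_maps_lincomb:
  assumes W: "\<And>u w. u \<in> W \<Longrightarrow> w \<in> W \<Longrightarrow> a *\<^sub>R u + b *\<^sub>R w \<in> W"
    and "f \<in> linear_maps V W" "g \<in> linear_maps V W"
  shows "a *\<^sub>R f + b *\<^sub>R g \<in> linear_maps V W"
proof -
  have eq: "(a *\<^sub>R f + b *\<^sub>R g) p = a *\<^sub>R f p + b *\<^sub>R g p" for p by simp
  show ?thesis using assms unfolding linear_maps_def mem_Collect_eq eq
    by (auto simp: image_subset_iff algebra_simps)
qed

text \<open>The coefficients may depend on the degree, so that this covers both the vector space
  structure and the rescaling by \<open>zeta\<close>.\<close>

lemma cochains_lincomb:
  assumes "smooth_manifold M A" "\<eta> \<in> cochains M A D r" "\<theta> \<in> cochains M A D r"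
  shows "(\<lambda>k. s k *\<^sub>R \<eta> k + t k *\<^sub>R \<theta> k) \<in> cochains M A D r"
  using assms unfolding cochains_def by (auto intro!: linear_maps_lincomb forms_lincomb)

lemma cochains_0: "0 \<in> cochains M A D r"
  by (auto simp: cochains_def linear_maps_def forms_0)

lemma cochains_scale:
  assumes "smooth_manifold M A" "\<eta> \<in> cochains M A D r"
  shows "(\<lambda>k. s k *\<^sub>R \<eta> k) \<in> cochains M A D r"
  using cochains_lincomb[OF assms cochains_0, of s s] by simp

lemma act_cochain_lincomb:
  assumes "smooth_manifold M A" "v x \<in> vector_fields M A"
    and "\<eta> \<in> cochains M A D r" "\<theta> \<in> cochains M A D r"
  shows "act_cochain M A br v D x (a *\<^sub>R \<eta> + b *\<^sub>R \<theta>) =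
    a *\<^sub>R act_cochain M A br v D x \<eta> + b *\<^sub>R act_cochain M A br v D x \<theta>"
  using lie_deriv_forms_lincomb[OF assms(1,2) cochains_apply_in_forms[OF assms(3)]
      cochains_apply_in_forms[OF assms(4)]]
  by (intro ext) (simp add: act_cochain_def algebra_simps)

lemma inv_cochains_lincomb:
  assumes "smooth_manifold M A" "\<And>x. v x \<in> vector_fields M A"
    and "\<eta> \<in> inv_cochains M A br v D r" "\<theta> \<in> inv_cochains M A br v D r"
  shows "a *\<^sub>R \<eta> + b *\<^sub>R \<theta> \<in> inv_cochains M A br v D r"
proof -
  have "a *\<^sub>R \<eta> + b *\<^sub>R \<theta> = (\<lambda>k. a *\<^sub>R \<eta> k + b *\<^sub>R \<theta> k)" by (simp add: fun_eq_iff)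
  then have "a *\<^sub>R \<eta> + b *\<^sub>R \<theta> \<in> cochains M A D r"
    using assms(3,4) cochains_lincomb[OF assms(1), of \<eta> D r \<theta> "\<lambda>_. a" "\<lambda>_. b"]
    by (simp add: inv_cochains_def)
  moreover have "act_cochain M A br v D x (a *\<^sub>R \<eta> + b *\<^sub>R \<theta>) = 0" for x
    using assms(3,4) by (simp add: inv_cochains_def act_cochain_lincomb[OF assms(1,2), of _ D r])
  ultimately show ?thesis by (simp add: inv_cochains_def)
qed

text \<open>Invariance tests all degrees and arguments, equivariance only degrees in
  \<open>{1..n}\<close> and arguments in \<open>D k\<close>. Elsewhere the action gives 0: by its
  default value, or because the component and its Lie derivative vanish.\<close>

lemma inv_cochains_iff_equivariant:
  assumes man: "smooth_manifold M A" and v: "\<And>x. v x \<in> vector_fields M A"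
  shows "\<eta> \<in> inv_cochains M A br v D n \<longleftrightarrow> \<eta> \<in> cochains M A D n \<and> equivariant M A n br v D \<eta>"
proof (cases "\<eta> \<in> cochains M A D n")
  case True
  have "act_cochain M A br v D x \<eta> = 0 \<longleftrightarrow>
      (\<forall>k\<in>{1..n}. \<forall>p\<in>D k. \<eta> k (ad br k x p) = lie_deriv M A (v x) (\<eta> k p))" for x
  proof -
    have "\<eta> k = 0" if "k \<notin> {1..n}" for k using True that by (auto simp: cochains_def)
    then have "act_cochain M A br v D x \<eta> k p = 0" if "k \<notin> {1..n}" for k p
      using that by (simp add: act_cochain_def lie_deriv_0[OF man v])
    then have "act_cochain M A br v D x \<eta> = 0 \<longleftrightarrow>
       (\<forall>k\<in>{1..n}. \<forall>p. act_cochain M A br v D x \<eta> k p = 0)"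
      by (metis (no_types, lifting) ext zero_fun_apply)
    also have "\<dots> \<longleftrightarrow> (\<forall>k\<in>{1..n}. \<forall>p\<in>D k. lie_deriv M A (v x) (\<eta> k p) = \<eta> k (ad br k x p))"
      by (intro ball_cong refl) (auto simp: act_cochain_def)
    finally show ?thesis by metis
  qed
  then show ?thesis using True by (auto simp: inv_cochains_def equivariant_def)
qed (simp add: inv_cochains_def)

lemma equivariant_scale:
  assumes "smooth_manifold M A" "\<And>x. v x \<in> vector_fields M A" "\<eta> \<in> cochains M A D n"
    and "equivariant M A n br v D \<eta>"
  shows "equivariant M A n br v D (\<lambda>k. s k *\<^sub>R \<eta> k)"
  using assms lie_deriv_scaleR[OF assms(1,2) cochains_apply_in_forms[OF assms(3)]]
  by (simp add: equivariant_def)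

section \<open>Linearity of the total differentials\<close>

lemma de_rham_part_lincomb:
  assumes "smooth_manifold M A" "\<eta> \<in> cochains M A D r" "\<theta> \<in> cochains M A D r"
  shows "de_rham_part M A D (a *\<^sub>R \<eta> + b *\<^sub>R \<theta>) =
    a *\<^sub>R de_rham_part M A D \<eta> + b *\<^sub>R de_rham_part M A D \<theta>"
  using ext_deriv_forms_lincomb[OF assms(1) cochains_apply_in_forms[OF assms(2)]
      cochains_apply_in_forms[OF assms(3)]]
  by (intro ext) (simp add: de_rham_part_def algebra_simps)

lemma ce_part_lincomb: "ce_part br (a *\<^sub>R \<eta> + b *\<^sub>R \<theta>) = a *\<^sub>R ce_part br \<eta> + b *\<^sub>R ce_part br \<theta>"
  by (intro ext) (simp add: ce_part_def)

lemma d_hat_lincomb: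
  assumes "smooth_manifold M A" "\<eta> \<in> cochains M A (lie_kernel br) r" "\<theta> \<in> cochains M A (lie_kernel br) r"
  shows "d_hat M A br (a *\<^sub>R \<eta> + b *\<^sub>R \<theta>) = a *\<^sub>R d_hat M A br \<eta> + b *\<^sub>R d_hat M A br \<theta>"
  unfolding d_hat_def using assms by (rule de_rham_part_lincomb)

lemma d_tilde_lincomb:
  assumes "smooth_manifold M A" "\<eta> \<in> cochains M A ext_power r" "\<theta> \<in> cochains M A ext_power r"
  shows "d_tilde M A br (a *\<^sub>R \<eta> + b *\<^sub>R \<theta>) = a *\<^sub>R d_tilde M A br \<eta> + b *\<^sub>R d_tilde M A br \<theta>"
  unfolding d_tilde_def de_rham_part_lincomb[OF assms] ce_part_lincomb
  by (simp add: algebra_simps)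

section \<open>Signs, and moment maps as potentials\<close>

lemma zeta_square [simp]: "zeta k * zeta k = 1"
  by (simp add: zeta_def flip: power_add mult_2)

text \<open>The exponents are triangular numbers, and consecutive ones differ by
  \<open>Suc k\<close>.\<close>

lemma zeta_Suc: "zeta (Suc k) = - ((-1) ^ k) * zeta k"
proof -
  have "Suc k * (Suc k + 1) div 2 = k * (k + 1) div 2 + Suc k"
    by (simp add: algebra_simps)
  then show ?thesis by (simp add: zeta_def power_add)
qed

text \<open>In degree \<open>k\<close> both sides carry the sign \<open>(-1) ^ k\<close>, up to the
  minus from \<open>(-1) ^ (k - 1)\<close>. Cancelling it and multiplying by \<open>zeta k\<close>
  gives the weak moment map equation.\<close>

lemma d_hat_eq_omega_hat_iff:
  assumes man: "smooth_manifold M A" and \<eta>: "\<eta> \<in> cochains M A (lie_kernel br) n"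
  shows "d_hat M A br \<eta> = omega_hat n \<omega> br v \<longleftrightarrow> weak_moment_map M A n \<omega> br v (\<lambda>k. zeta k *\<^sub>R \<eta> k)"
proof -
  have out: "\<eta> k = 0" if "k \<notin> {1..n}" for k using \<eta> that by (auto simp: cochains_def)
  have "d_hat M A br \<eta> k p = omega_hat n \<omega> br v k p \<longleftrightarrow>
      (k \<in> {1..n} \<and> p \<in> lie_kernel br k \<longrightarrow>
         ext_deriv M A (zeta k *\<^sub>R \<eta> k p) = - zeta k *\<^sub>R contraction v \<omega> p)" for k p
  proof (cases "k \<in> {1..n} \<and> p \<in> lie_kernel br k")
    case True
    then obtain l where k: "k = Suc l" by (cases k) auto
    have z: "zeta k \<noteq> 0" by (simp add: zeta_def)
    have "d_hat M A br \<eta> k p = omega_hat n \<omega> br v k p \<longleftrightarrow>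
        (-1) ^ k *\<^sub>R ext_deriv M A (\<eta> k p) = (-1 :: real) ^ k *\<^sub>R - contraction v \<omega> p"
      using True by (simp add: d_hat_def de_rham_part_def omega_hat_def k)
    also have "\<dots> \<longleftrightarrow> ext_deriv M A (\<eta> k p) = - contraction v \<omega> p"
      by (subst scaleR_cancel_left) simp
    also have "\<dots> \<longleftrightarrow> zeta k *\<^sub>R ext_deriv M A (\<eta> k p) = zeta k *\<^sub>R - contraction v \<omega> p"
      using z by (subst scaleR_cancel_left) simp
    finally show ?thesis
      using True ext_deriv_scaleR[OF man cochains_apply_in_forms[OF \<eta>]] by simp
  next
    case False
    then show ?thesis
      by (auto simp: d_hat_def de_rham_part_def omega_hat_def out ext_deriv_0[OF man])
  qed
  \<comment> \<open>Extensionality is used for the degree and the multivector only; the values,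
    themselves functions, stay forms.\<close>
  then have "d_hat M A br \<eta> = omega_hat n \<omega> br v \<longleftrightarrow> (\<forall>k p. k \<in> {1..n} \<and> p \<in> lie_kernel br k \<longrightarrow>
         ext_deriv M A (zeta k *\<^sub>R \<eta> k p) = - zeta k *\<^sub>R contraction v \<omega> p)"
    by (simp add: fun_eq_iff[where f = "d_hat M A br \<eta>"] fun_eq_iff[where f = "d_hat M A br \<eta> _"])
  then show ?thesis
    using cochains_scale[OF man \<eta>] by (auto simp: weak_moment_map_def)
qed

text \<open>The degree \<open>k\<close> equation couples \<eta> in degrees \<open>k\<close> and
  \<open>k - 1\<close>, whose rescalings differ by a sign that \<open>zeta_Suc\<close> matches with
  the signs of the total complex. The boundary degrees 1 and \<open>n + 1\<close> fit in because
  \<open>\<eta> 0\<close> and \<open>\<eta> (n + 1)\<close> are 0.\<close>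

lemma d_tilde_eq_omega_tilde_iff:
  assumes man: "smooth_manifold M A" and \<eta>: "\<eta> \<in> cochains M A ext_power n"
  shows "d_tilde M A br \<eta> = omega_tilde n \<omega> v \<longleftrightarrow> homotopy_moment_map M A n \<omega> br v (\<lambda>k. zeta k *\<^sub>R \<eta> k)"
proof -
  have out: "\<eta> k = 0" if "k \<notin> {1..n}" for k using \<eta> that by (auto simp: cochains_def)
  let ?eq = "\<lambda>k p. - (zeta (k - 1) *\<^sub>R \<eta> (k - 1) (boundary br k p)) =
     ext_deriv M A (zeta k *\<^sub>R \<eta> k p) + zeta k *\<^sub>R contraction v \<omega> p"
  have "d_tilde M A br \<eta> k p = omega_tilde n \<omega> v k p \<longleftrightarrow> (k \<in> {1..n + 1} \<and> p \<in> ext_power k \<longrightarrow> ?eq k p)"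
    for k p
  proof (cases "k \<in> {1..n + 1} \<and> p \<in> ext_power k")
    case True
    then obtain l where k: "k = Suc l" by (cases k) auto
    define s :: real where "s = (-1) ^ l"
    define F where "F = \<eta> l (boundary br k p)"
    define G where "G = ext_deriv M A (\<eta> k p)"
    define H where "H = contraction v \<omega> p"
    have z: "zeta l \<noteq> 0" by (simp add: zeta_def)
    have dz: "ext_deriv M A (zeta k *\<^sub>R \<eta> k p) = zeta k *\<^sub>R G"
      using True unfolding G_def by (intro ext_deriv_scaleR[OF man cochains_apply_in_forms[OF \<eta>]]) auto
    \<comment> \<open>With \<open>k = Suc l\<close>, the de Rham part has sign \<open>- s\<close>
      and \<open>omega_tilde\<close> has sign \<open>s\<close>.\<close>
    have "d_tilde M A br \<eta> k p = omega_tilde n \<omega> v k p \<longleftrightarrow> F - s *\<^sub>R G = s *\<^sub>R H"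
      using True by (simp add: d_tilde_def ce_part_def de_rham_part_def omega_tilde_def k s_def F_def G_def H_def)
    also have "\<dots> \<longleftrightarrow> F = s *\<^sub>R G + s *\<^sub>R H" by (simp add: algebra_simps)
    \<comment> \<open>The factor is chosen because \<open>- zeta l * s = zeta k\<close>.\<close>
    also have "\<dots> \<longleftrightarrow> - zeta l *\<^sub>R F = - zeta l *\<^sub>R (s *\<^sub>R G + s *\<^sub>R H)" using z by (subst scaleR_cancel_left) simp
    also have "\<dots> \<longleftrightarrow> ?eq k p"
      unfolding dz by (simp add: k zeta_Suc F_def H_def s_def scaleR_add_right mult.commute)
    finally show ?thesis using True by simp
  next
    case False
    \<comment> \<open>Either \<open>k = 0\<close>, and then \<open>k - 1\<close> is 0 too, or
      \<open>k - 1\<close> exceeds \<open>n\<close>.\<close>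
    have "\<eta> k = 0 \<and> \<eta> (k - 1) = 0" if "k \<notin> {1..n + 1}" using that by (auto intro!: out)
    with False show ?thesis
      by (cases "p \<in> ext_power k")
        (auto simp: d_tilde_def ce_part_def de_rham_part_def omega_tilde_def ext_deriv_0[OF man])
  qed
  then have "d_tilde M A br \<eta> = omega_tilde n \<omega> v \<longleftrightarrow>
      (\<forall>k p. k \<in> {1..n + 1} \<and> p \<in> ext_power k \<longrightarrow> ?eq k p)"
    by (simp add: fun_eq_iff[where f = "d_tilde M A br \<eta>"] fun_eq_iff[where f = "d_tilde M A br \<eta> _"])
  then show ?thesis
    using cochains_scale[OF man \<eta>] by (auto simp: homotopy_moment_map_def)
qed

section \<open>Vanishing classes and existence of potentials\<close>

text \<open>The class is the translate by \<open>c\<close> of the set of coboundaries, and the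
  neutral element is that set itself. As the set contains 0 and is closed under differences, the two
  agree exactly when it contains \<open>c\<close>.\<close>

lemma cohomology_class_eq_one_iff:
  assumes C0: "0 \<in> C r" and diff: "\<And>a b. a \<in> C r \<Longrightarrow> b \<in> C r \<Longrightarrow> a - b \<in> C r"
    and d: "\<And>a b. a \<in> C r \<Longrightarrow> b \<in> C r \<Longrightarrow> d (a - b) = d a - d b"
  shows "cohomology_class C d (r + 1) c = \<one>\<^bsub>cohomology C d (r + 1)\<^esub> \<longleftrightarrow> c \<in> d ` C r"
proof -
  let ?H = "d ` C r"
  have H0: "0 \<in> ?H" using d[OF C0 C0] C0 by (metis diff_self image_eqI)
  have Hd: "h - h' \<in> ?H" if "h \<in> ?H" "h' \<in> ?H" for h h'
    using that by (auto simp: diff simp flip: d)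
  \<comment> \<open>Closure under sums comes from differences:
    \<open>h + h' = h - (0 - h')\<close>.\<close>
  have Ha: "h + h' \<in> ?H" if "h \<in> ?H" "h' \<in> ?H" for h h'
    using Hd[OF that(1) Hd[OF H0 that(2)]] by simp
  have "cohomology_class C d (r + 1) c = (\<lambda>h. h + c) ` ?H"
    by (auto simp: cohomology_class_def coboundaries_def r_coset_def cocycles_def)
  moreover have "\<one>\<^bsub>cohomology C d (r + 1)\<^esub> = ?H"
    by (simp add: cohomology_def coboundaries_def FactGroup_def)
  moreover have "(\<lambda>h. h + c) ` ?H = ?H \<longleftrightarrow> c \<in> ?H"
  proof
    assume "(\<lambda>h. h + c) ` ?H = ?H"
    with H0 show "c \<in> ?H" by (metis add_0 imageI)
  next
    assume c: "c \<in> ?H"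
    have "h \<in> (\<lambda>h. h + c) ` ?H" if "h \<in> ?H" for h
      using Hd[OF that c] by (metis diff_add_cancel imageI)
    then show "(\<lambda>h. h + c) ` ?H = ?H" using Ha[OF _ c] by blast
  qed
  ultimately show ?thesis by simp
qed

text \<open>Serves the weak and the homotopy case alike. Rescaling by \<open>zeta\<close> is its own
  inverse by \<open>zeta_square\<close>, and it preserves equivariance because the Lie derivative
  commutes with scalars.\<close>

lemma moment_maps_bij_potentials:
  assumes man: "smooth_manifold M A" and v: "\<And>x. v x \<in> vector_fields M A"
    and C: "C = inv_cochains M A br v D"
    and sub: "\<And>f. moment f \<Longrightarrow> f \<in> cochains M A D n"
    and iff: "\<And>\<eta>. \<eta> \<in> cochains M A D n \<Longrightarrow> d \<eta> = \<theta> \<longleftrightarrow> moment (\<lambda>k. zeta k *\<^sub>R \<eta> k)"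
  shows "bij_betw (\<lambda>\<alpha> k. zeta k *\<^sub>R \<alpha> k) {\<alpha> \<in> C n. d \<alpha> = \<theta>} {f. moment f \<and> equivariant M A n br v D f}"
proof (rule bij_betw_byWitness[where f' = "\<lambda>\<alpha> k. zeta k *\<^sub>R \<alpha> k"])
  note inv = inv_cochains_iff_equivariant[where br = br and D = D and n = n, OF man v]
  note scale = cochains_scale[OF man] equivariant_scale[OF man v]
  show "(\<lambda>\<alpha> k. zeta k *\<^sub>R \<alpha> k) ` {\<alpha> \<in> C n. d \<alpha> = \<theta>} \<subseteq> {f. moment f \<and> equivariant M A n br v D f}"
    by (auto simp: C inv scale iff[symmetric])
  \<comment> \<open>Here \<open>iff\<close> is applied to the rescaled \<open>f\<close>; rescaling
    once more returns \<open>f\<close>.\<close>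
  show "(\<lambda>\<alpha> k. zeta k *\<^sub>R \<alpha> k) ` {f. moment f \<and> equivariant M A n br v D f} \<subseteq> {\<alpha> \<in> C n. d \<alpha> = \<theta>}"
    using sub by (auto simp: C inv scale iff)
qed simp_all

text \<open>The class vanishes iff \<theta> has a potential, and the bijection carries nonemptiness
  over to \<open>F\<close>.\<close>

lemma exists_moment_map_iff:
  assumes man: "smooth_manifold M A" and v: "\<And>x. v x \<in> vector_fields M A"
    and C: "C = inv_cochains M A br v D"
    and d: "\<And>\<eta> \<theta> a b. \<eta> \<in> cochains M A D n \<Longrightarrow> \<theta> \<in> cochains M A D n \<Longrightarrow>
      d (a *\<^sub>R \<eta> + b *\<^sub>R \<theta>) = a *\<^sub>R d \<eta> + b *\<^sub>R d \<theta>"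
    and bij: "bij_betw \<phi> {\<alpha> \<in> C n. d \<alpha> = \<theta>} F"
  shows "(\<exists>f. f \<in> F) \<longleftrightarrow> cohomology_class C d (n + 1) \<theta> = \<one>\<^bsub>cohomology C d (n + 1)\<^esub>"
proof -
  have "cohomology_class C d (n + 1) \<theta> = \<one>\<^bsub>cohomology C d (n + 1)\<^esub> \<longleftrightarrow> \<theta> \<in> d ` C n"
  proof (rule cohomology_class_eq_one_iff)
    show "0 \<in> C n"
      by (simp add: C inv_cochains_iff_equivariant[OF man v] cochains_0 equivariant_def lie_deriv_0[OF man v])
    show "a - b \<in> C n" if "a \<in> C n" "b \<in> C n" for a b
      \<comment> \<open>Differences are the linear combinations with coefficients 1 and -1.\<close>
      using inv_cochains_lincomb[where a = 1 and b = "-1", OF man v that[unfolded C]]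
      by (simp only: C scaleR_one scaleR_minus1_left add_uminus_conv_diff)
    show "d (a - b) = d a - d b" if "a \<in> C n" "b \<in> C n" for a b
    proof -
      have "a \<in> cochains M A D n" "b \<in> cochains M A D n" using that by (auto simp: C inv_cochains_def)
      from d[where a = 1 and b = "-1", OF this] show ?thesis
        by (simp only: scaleR_one scaleR_minus1_left add_uminus_conv_diff)
    qed
  qed
  also have "\<dots> \<longleftrightarrow> {\<alpha> \<in> C n. d \<alpha> = \<theta>} \<noteq> {}" by auto
  also have "\<dots> \<longleftrightarrow> F \<noteq> {}" by (simp only: bij_betw_imp_surj_on[OF bij, symmetric] image_is_empty)
  finally show ?thesis by (simp only: ex_in_conv)
qed

theorem theorem3p4:
  fixes M :: "'m topology" and A :: "('m, 'e::real_inner) chart set"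
    and n :: nat and \<omega> :: "('m, 'e) dform"
    and br :: "'g::real_vector \<Rightarrow> 'g \<Rightarrow> 'g" and v :: "'g \<Rightarrow> 'm \<Rightarrow> ('m, 'e) tvec"
  assumes "smooth_manifold M A" and "n_plectic M A n \<omega>"
    and "lie_algebra br" and "finite_dim TYPE('g)"
    and "lie_action M A br v" and "preserves M A v \<omega>"
  shows
    "let C_hat = inv_cochains M A br v (lie_kernel br);
         C_tilde = inv_cochains M A br v ext_power;
         weak = {f. weak_moment_map M A n \<omega> br v f \<and> equivariant M A n br v (lie_kernel br) f};
         homotopy = {f. homotopy_moment_map M A n \<omega> br v f \<and> equivariant M A n br v ext_power f}
     in ((\<exists>f. f \<in> weak) \<longleftrightarrow>
           cohomology_class C_hat (d_hat M A br) (n + 1) (omega_hat n \<omega> br v) =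
             \<one>\<^bsub>cohomology C_hat (d_hat M A br) (n + 1)\<^esub>) \<and>
        ((\<exists>f. f \<in> homotopy) \<longleftrightarrow>
           cohomology_class C_tilde (d_tilde M A br) (n + 1) (omega_tilde n \<omega> v) =
             \<one>\<^bsub>cohomology C_tilde (d_tilde M A br) (n + 1)\<^esub>) \<and>
        bij_betw (\<lambda>\<alpha> k. zeta k *\<^sub>R \<alpha> k)
          {\<alpha> \<in> C_hat n. d_hat M A br \<alpha> = omega_hat n \<omega> br v} weak \<and>
        bij_betw (\<lambda>\<alpha> k. zeta k *\<^sub>R \<alpha> k)
          {\<alpha> \<in> C_tilde n. d_tilde M A br \<alpha> = omega_tilde n \<omega> v} homotopy"
proof -
  note man = assms(1)
  have v: "v x \<in> vector_fields M A" for x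
    using assms(5) by (simp add: lie_action_def)
  \<comment> \<open>The two cases differ only in the domains, Lie kernels or full exterior powers,
    and in the equation relating potentials to moment maps.\<close>
  have bij:
    "bij_betw (\<lambda>\<alpha> k. zeta k *\<^sub>R \<alpha> k)
       {\<alpha> \<in> inv_cochains M A br v (lie_kernel br) n. d_hat M A br \<alpha> = omega_hat n \<omega> br v}
       {f. weak_moment_map M A n \<omega> br v f \<and> equivariant M A n br v (lie_kernel br) f}"
    "bij_betw (\<lambda>\<alpha> k. zeta k *\<^sub>R \<alpha> k)
       {\<alpha> \<in> inv_cochains M A br v ext_power n. d_tilde M A br \<alpha> = omega_tilde n \<omega> v}
       {f. homotopy_moment_map M A n \<omega> br v f \<and> equivariant M A n br v ext_power f}"
    by (rule moment_maps_bij_potentials[OF man v refl];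
        simp add: weak_moment_map_def d_hat_eq_omega_hat_iff[OF man]
          homotopy_moment_map_def d_tilde_eq_omega_tilde_iff[OF man])+
  show ?thesis
    unfolding Let_def
    by (intro conjI bij exists_moment_map_iff[OF man v refl _ bij(1)]
        exists_moment_map_iff[OF man v refl _ bij(2)] d_hat_lincomb[OF man] d_tilde_lincomb[OF man])
qed

end
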